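(* Let $a,b\ge1$ be integers and let $p=p(a,b)$. Then $p$ is prime if and only if there exist integers $w_2,w_3$ such that, for each $\nu\in\{2,3\}$, $$w_\nu^{\,p-1}\equiv1\pmod p,\qquad \gcd\bigl(w_\nu^{(p-1)/\nu}-1,\;p\bigr)=1.$$ In particular, primality of $p(a,b)$ is decidable unconditionally in time polynomial in $\log p$, with witness search restricted to $\nu\in\{2,3\}$.
   Context: For integers $a,b\ge1$, $m(a,b):=2^a3^b-1$ and $p(a,b):=3m(m+1)+1$ with $m=m(a,b)$. *)

theory Defs
  imports
    Complex_Main
    "HOL-Computational_Algebra.Primes"
    "HOL-Number_Theory.Cong"
    "HOL-Library.Log_Nat"
begin

(* The truncated subtraction is exact, since 2 ^ a * 3 ^ b > 0. *)
definition m_of :: "nat \<Rightarrow> nat \<Rightarrow> nat" where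
  "m_of a b = 2 ^ a * 3 ^ b - 1"

definition p_of :: "nat \<Rightarrow> nat \<Rightarrow> nat" where
  "p_of a b = 3 * m_of a b * (m_of a b + 1) + 1"

(* For p = p_of a b with a, b > 0 and nu in {2, 3} the quotient (p - 1) div nu is exact:
   p - 1 = 3 * m * (m + 1) and m + 1 = 2 ^ a * 3 ^ b. *)
definition witness :: "nat \<Rightarrow> nat \<Rightarrow> int \<Rightarrow> bool" where
  "witness p \<nu> w \<longleftrightarrow>
     [w ^ (p - 1) = 1] (mod int p) \<and> gcd (w ^ ((p - 1) div \<nu>) - 1) (int p) = 1"


(* Model of computation: deterministic while programs over finitely many registers that hold
   natural numbers in binary. The cost is bit complexity: an arithmetic operation on operands
   of k and l bits costs (1 + k) * (1 + l), the cost of the schoolbook algorithms, so running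
   times agree with those of multitape Turing machines up to a polynomial. Subtraction is
   truncated, x div 0 = 0 and x mod 0 = x. A guard counts as true iff its value is nonzero. *)

datatype binop = Add | Sub | Mul | Div | Mod

datatype aexp = Num nat | Reg nat | Bin binop aexp aexp

datatype com =
    Skip
  | Assign nat aexp
  | Seq com com
  | If aexp com com
  | While aexp com

type_synonym state = "nat \<Rightarrow> nat"

fun apply_op :: "binop \<Rightarrow> nat \<Rightarrow> nat \<Rightarrow> nat" where
  "apply_op Add x y = x + y"
| "apply_op Sub x y = x - y"
| "apply_op Mul x y = x * y"
| "apply_op Div x y = x div y"
| "apply_op Mod x y = x mod y"

fun aval :: "aexp \<Rightarrow> state \<Rightarrow> nat" where
  "aval (Num n) s = n"
| "aval (Reg r) s = s r"
| "aval (Bin f e1 e2) s = apply_op f (aval e1 s) (aval e2 s)"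

(* floorlog 2 n is the number of binary digits of n, with floorlog 2 0 = 0. *)
fun acost :: "aexp \<Rightarrow> state \<Rightarrow> nat" where
  "acost (Num n) s = 1 + floorlog 2 n"
| "acost (Reg r) s = 1 + floorlog 2 (s r)"
| "acost (Bin f e1 e2) s = acost e1 s + acost e2 s
     + (1 + floorlog 2 (aval e1 s)) * (1 + floorlog 2 (aval e2 s))"

(* exec c s t s': started in s, the program c terminates in s' after t bit operations. *)
inductive exec :: "com \<Rightarrow> state \<Rightarrow> nat \<Rightarrow> state \<Rightarrow> bool" where
  Skip: "exec Skip s 1 s"
| Assign: "exec (Assign r e) s (1 + acost e s) (s(r := aval e s))"
| Seq: "exec c1 s t1 s1 \<Longrightarrow> exec c2 s1 t2 s2 \<Longrightarrow> exec (Seq c1 c2) s (t1 + t2) s2"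
| IfTrue: "aval e s \<noteq> 0 \<Longrightarrow> exec c1 s t s1 \<Longrightarrow> exec (If e c1 c2) s (1 + acost e s + t) s1"
| IfFalse: "aval e s = 0 \<Longrightarrow> exec c2 s t s1 \<Longrightarrow> exec (If e c1 c2) s (1 + acost e s + t) s1"
| WhileFalse: "aval e s = 0 \<Longrightarrow> exec (While e c) s (1 + acost e s) s"
| WhileTrue: "aval e s \<noteq> 0 \<Longrightarrow> exec c s t1 s1 \<Longrightarrow> exec (While e c) s1 t2 s2 \<Longrightarrow>
    exec (While e c) s (1 + acost e s + t1 + t2) s2"

inductive_cases SkipE: "exec Skip s t s'"
inductive_cases AssignE: "exec (Assign r e) s t s'"
inductive_cases SeqE: "exec (Seq c1 c2) s t s'"
inductive_cases IfE: "exec (If e c1 c2) s t s'"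
inductive_cases WhileE: "exec (While e c) s t s'"

lemma exec_deterministic:
  "exec c s t s1 \<Longrightarrow> exec c s t' s2 \<Longrightarrow> t' = t \<and> s2 = s1"
proof (induction arbitrary: t' s2 rule: exec.induct)
  case (Skip s)
  then show ?case by (rule SkipE) simp
next
  case (Assign r e s)
  then show ?case by (rule AssignE) simp
next
  case (Seq c1 s t1 s1 c2 t2 s3)
  from Seq.prems obtain u1 r u2
    where *: "t' = u1 + u2" "exec c1 s u1 r" "exec c2 r u2 s2" by (rule SeqE)
  have r: "u1 = t1 \<and> r = s1" using *(2) by (rule Seq.IH(1))
  have "u2 = t2 \<and> s2 = s3" by (rule Seq.IH(2)) (use *(3) r in simp)
  with r show ?case by (simp add: *(1))
next
  case (IfTrue e s c1 t s1 c2)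
  from IfTrue.prems obtain u where *: "t' = 1 + acost e s + u" "exec c1 s u s2"
    by (rule IfE) (use IfTrue.hyps in simp_all)
  have "u = t \<and> s2 = s1" using *(2) by (rule IfTrue.IH)
  then show ?case by (simp add: *(1))
next
  case (IfFalse e s c2 t s1 c1)
  from IfFalse.prems obtain u where *: "t' = 1 + acost e s + u" "exec c2 s u s2"
    by (rule IfE) (use IfFalse.hyps in simp_all)
  have "u = t \<and> s2 = s1" using *(2) by (rule IfFalse.IH)
  then show ?case by (simp add: *(1))
next
  case (WhileFalse e s c)
  from WhileFalse.prems show ?case
    by (rule WhileE) (use WhileFalse.hyps in simp_all)
next
  case (WhileTrue e s c t1 s1 t2 s3)
  from WhileTrue.prems obtain u1 r u2
    where *: "t' = 1 + acost e s + u1 + u2" "exec c s u1 r" "exec (While e c) r u2 s2"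
    by (rule WhileE) (use WhileTrue.hyps in simp_all)
  have r: "u1 = t1 \<and> r = s1" using *(2) by (rule WhileTrue.IH(1))
  have "u2 = t2 \<and> s2 = s3" by (rule WhileTrue.IH(2)) (use *(3) r in simp)
  with r show ?case by (simp add: *(1))
qed

(* The inputs occupy the first registers, all others are 0. *)
definition init :: "nat list \<Rightarrow> state" where
  "init xs = (\<lambda>r. if r < length xs then xs ! r else 0)"

(* On input xs the program halts within T bit operations and answers the question Q
   correctly: register 0 finally holds a nonzero value iff Q. *)
definition decides_within :: "com \<Rightarrow> nat list \<Rightarrow> bool \<Rightarrow> real \<Rightarrow> bool" where
  "decides_within c xs Q T \<longleftrightarrow>
     (\<exists>t s. exec c (init xs) t s \<and> (s 0 \<noteq> 0 \<longleftrightarrow> Q) \<and> real t \<le> T)"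

end

theory Submission
  imports Defs "HOL-Number_Theory.Number_Theory"
begin

text \<open>
Write \<open>p = p_of a b\<close> and \<open>m = m_of a b\<close>. Then \<open>p - 1 = m * F\<close> with \<open>F = 2 ^ a * 3 ^ (b + 1)\<close>, where
\<open>m\<close> is coprime to 6 and \<open>F\<^sup>2 > p\<close>: the completely factored part of \<open>p - 1\<close> exceeds the square root
of \<open>p\<close>, and 2 and 3 are its only primes. Everything below exploits this.

Witness criterion (\<open>prime_iff_witnesses\<close>). A witness for \<open>\<nu>\<close> forces the full power of \<open>\<nu>\<close> in \<open>p - 1\<close>
to divide \<open>r - 1\<close> for every prime \<open>r\<close> dividing \<open>p\<close> (\<open>certified_prime_power_dvd\<close>, Pocklington's
argument). Witnesses for both 2 and 3 give \<open>F\<close> dividing \<open>r - 1\<close>, so every prime factor of \<open>p\<close> exceeds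
the square root of \<open>p\<close>. Conversely a primitive root serves as both witnesses.

Deterministic decision. Searching for witnesses among small numbers is not known to succeed
without unproved hypotheses, so the decision procedure follows the idea of Konyagin and Pomerance
and makes do with whatever the small numbers prove. Starting with \<open>e = p - 1\<close>, divide \<open>e\<close> by 2, and
afterwards by 3, until \<open>e\<close> contains no further factor \<open>\<nu>\<close> or some \<open>w\<close> up to a bound \<open>W < p\<close>, polynomial
in \<open>log p\<close>, satisfies the witness conditions with \<open>e\<close> in place of \<open>p - 1\<close>. The result is \<open>e = m * E\<close> with \<open>E\<close> dividing \<open>F\<close>, and

\<^item> \<open>E\<close> divides \<open>r - 1\<close> for every prime \<open>r\<close> dividing \<open>p\<close>, whether \<open>p\<close> is prime or not;

\<^item> if \<open>p\<close> is prime, then \<open>w ^ e = 1\<close> modulo \<open>p\<close> for \<open>w = 1, ..., W\<close>.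

In the second case all products of small primes are roots of \<open>x ^ e = 1\<close>, and by a Chebyshev bound
there are so many of them below \<open>p\<close> that \<open>e ^ 6 \<ge> p ^ 5\<close> (\<open>small_residues_exponent_bound\<close>), whence
\<open>E ^ 3 > p\<close> (\<open>cube_gt_of_exponent_bound\<close>). So \<open>E ^ 3 \<le> p\<close> proves \<open>p\<close> composite. If \<open>E ^ 3 > p\<close>, then all
divisors of \<open>p\<close> are 1 modulo \<open>E\<close>, a proper factorization must be \<open>(1 + x * E) * (1 + y * E)\<close>, and the
digits of \<open>(p - 1) div E\<close> in base \<open>E\<close> are \<open>x + y\<close> and \<open>x * y\<close>; a quadratic equation reveals the only
possible divisor (\<open>composite_divisor_formula\<close>), which is then tried.

Cost. Programs are analysed with a Hoare-style judgement \<open>runs M k c Q s\<close>, in which a command is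
charged one unit per elementary step as long as all values stay below a fixed bound \<open>M\<close>. With
\<open>M = 2 ^ (1000 * (a + b))\<close> a unit is a polynomial in \<open>a + b\<close>, and so is the number of units of every
program here; since \<open>a + b \<le> log 2 p\<close>, this is polynomial in \<open>log 2 p\<close>.
\<close>

section \<open>Pocklington certificates and the witness criterion\<close>

text \<open>
\<open>witness p \<nu>\<close> is the case \<open>e = p - 1\<close>; the decision procedure needs proper divisors \<open>e\<close> of \<open>p - 1\<close> too.
\<close>

definition certifies :: "nat \<Rightarrow> nat \<Rightarrow> nat \<Rightarrow> nat \<Rightarrow> bool" where
  "certifies n e \<nu> w \<longleftrightarrow>
     [w ^ e = 1] (mod n) \<and> gcd (int w ^ (e div \<nu>) - 1) (int n) = 1"

lemma witness_iff_certifies: "witness p \<nu> (int w) \<longleftrightarrow> certifies p (p - 1) \<nu> w"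
  unfolding witness_def certifies_def
  by (metis cong_int_iff of_nat_1 of_nat_power)

lemma witness_mod: "witness p \<nu> (w mod int p) \<longleftrightarrow> witness p \<nu> w"
proof -
  have "[(w mod int p) ^ k = w ^ k] (mod int p)" for k
    by (simp add: cong_def power_mod)
  then have "gcd ((w mod int p) ^ k - 1) (int p) = gcd (w ^ k - 1) (int p)"
    and "[(w mod int p) ^ k = 1] (mod int p) \<longleftrightarrow> [w ^ k = 1] (mod int p)" for k
    by (metis cong_diff cong_gcd_eq cong_refl, metis cong_def)
  then show ?thesis unfolding witness_def by simp
qed

text \<open>
If \<open>d\<close> contained fewer than \<open>i + 1\<close> factors \<open>q\<close>, its remaining part would divide \<open>k\<close> and \<open>d\<close> would
already divide \<open>k * q ^ i\<close>.
\<close>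

lemma prime_power_dvd_of_not_dvd:
  fixes d k q i :: nat
  assumes "d dvd k * q ^ Suc i" "\<not> d dvd k * q ^ i" "prime q"
  shows "q ^ Suc i dvd d"
proof (cases "d = 0")
  case False
  obtain j d' where d: "d = q ^ j * d'" "\<not> q dvd d'"
    using False \<open>prime q\<close> multiplicity_decompose'[of d q] by (metis not_prime_unit)
  have "coprime d' (q ^ Suc i)"
    using d(2) \<open>prime q\<close> by (metis coprime_commute coprime_power_right_iff prime_imp_coprime)
  moreover have "d' dvd k * q ^ Suc i" using assms(1) d(1) by (metis dvd_mult_right)
  ultimately have "d' dvd k" by (metis coprime_dvd_mult_left_iff)
  have "\<not> j \<le> i"
    using \<open>d' dvd k\<close> assms(2) d(1) by (metis le_imp_power_dvd mult.commute mult_dvd_mono)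
  then show ?thesis unfolding d(1) by (metis dvd_mult2 le_imp_power_dvd not_less_eq_eq)
qed simp

text \<open>
Pocklington's argument: the order of \<open>w\<close> modulo \<open>r\<close> divides \<open>e = k * q ^ i\<close>, but not \<open>e div q\<close>, because
\<open>r\<close> would otherwise divide the gcd in the certificate. Hence \<open>q ^ i\<close> divides the order, which divides
\<open>r - 1\<close>.
\<close>

lemma certified_prime_power_dvd:
  assumes "certifies n (k * q ^ i) q w" "prime q" "prime r" "r dvd n"
  shows "q ^ i dvd r - 1"
proof (cases i)
  case (Suc j)
  have "[w ^ (k * q ^ i) = 1] (mod r)"
    using assms unfolding certifies_def by (blast intro: cong_dvd_modulus_nat)
  then have 1: "ord r w dvd k * q ^ Suc j" unfolding Suc by (simp only: ord_divides)
  have "k * q ^ i div q = k * q ^ j" using \<open>prime q\<close> Suc by (simp add: prime_gt_0_nat)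
  then have g: "gcd (int w ^ (k * q ^ j) - 1) (int n) = 1"
    using assms(1) unfolding certifies_def by simp
  have 2: "\<not> ord r w dvd k * q ^ j"
  proof
    assume "ord r w dvd k * q ^ j"
    then have "[w ^ (k * q ^ j) = 1] (mod r)" by (simp only: ord_divides)
    then have "[int w ^ (k * q ^ j) = 1] (mod int r)"
      by (metis cong_int_iff of_nat_1 of_nat_power)
    then have "int r dvd int w ^ (k * q ^ j) - 1" by (simp add: cong_iff_dvd_diff)
    moreover have "int r dvd int n" using \<open>r dvd n\<close> by simp
    ultimately have "int r dvd 1" using g by (metis gcd_greatest)
    then show False using \<open>prime r\<close> by auto
  qed
  have "coprime r w"
  proof (rule ccontr)
    assume "\<not> coprime r w"
    then have "ord r w = 0" by simp
    then have "k = 0" using 1 \<open>prime q\<close> by auto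
    then show False using 2 by simp
  qed
  then have "ord r w dvd r - 1"
    using order_divides_totient[of r w] \<open>prime r\<close> by (simp add: totient_prime)
  with prime_power_dvd_of_not_dvd[OF 1 2 \<open>prime q\<close>] show ?thesis
    unfolding Suc using dvd_trans by blast
qed simp

lemma certifies_of_primroot:
  assumes "prime p" "ord p g = p - 1" "\<nu> dvd p - 1" "\<nu> > 1"
  shows "certifies p (p - 1) \<nu> g"
proof -
  have "[g ^ (p - 1) = 1] (mod p)" using ord_divides[of g "p - 1" p] assms(2) by simp
  moreover have "coprime (int g ^ ((p - 1) div \<nu>) - 1) (int p)"
  proof (rule ccontr)
    assume "\<not> ?thesis"
    then have "int p dvd int g ^ ((p - 1) div \<nu>) - 1"
      using \<open>prime p\<close> by (metis coprime_commute prime_imp_coprime prime_nat_int_transfer)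
    then have "[int g ^ ((p - 1) div \<nu>) = 1] (mod int p)" by (simp add: cong_iff_dvd_diff)
    then have "[g ^ ((p - 1) div \<nu>) = 1] (mod p)" by (metis cong_int_iff of_nat_1 of_nat_power)
    then have "p - 1 dvd (p - 1) div \<nu>" by (simp only: ord_divides assms(2))
    moreover have "0 < (p - 1) div \<nu>" "(p - 1) div \<nu> < p - 1"
      using assms prime_gt_1_nat[OF \<open>prime p\<close>] by (auto simp: div_greater_zero_iff dvd_imp_le)
    ultimately show False using dvd_imp_le leD by blast
  qed
  ultimately show ?thesis unfolding certifies_def by simp
qed

lemma p_of_pred: "p_of a b - 1 = m_of a b * 3 ^ Suc b * 2 ^ a"
  unfolding p_of_def m_of_def by simp

lemma m_of_bounds:
  assumes "a \<ge> 1" "b \<ge> 1"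
  shows "m_of a b \<ge> 5" "Suc (m_of a b) = 2 ^ a * 3 ^ b"
        "\<not> 2 dvd m_of a b" "\<not> 3 dvd m_of a b"
proof -
  have "2 * 3 \<le> (2::nat) ^ a * 3 ^ b"
    using assms by (intro mult_mono) (auto intro: self_le_power)
  then show 1: "m_of a b \<ge> 5" and 2: "Suc (m_of a b) = 2 ^ a * 3 ^ b"
    unfolding m_of_def by linarith+
  have "2 dvd Suc (m_of a b)" "3 dvd Suc (m_of a b)"
    unfolding 2 using assms by (auto simp: dvd_mult dvd_mult2)
  then show "\<not> 2 dvd m_of a b" "\<not> 3 dvd m_of a b" by presburger+
qed

lemma p_of_ge: "a \<ge> 1 \<Longrightarrow> b \<ge> 1 \<Longrightarrow> p_of a b \<ge> 91"
proof -
  assume "a \<ge> 1" "b \<ge> 1"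
  then have "m_of a b * (m_of a b + 1) \<ge> 5 * 6"
    using m_of_bounds(1) by (intro mult_mono) (auto simp: less_eq_Suc_le)
  then show ?thesis unfolding p_of_def by (simp only: mult.assoc)
qed

text \<open>
For the direction from witnesses to primality: if \<open>p\<close> were composite, its least prime factor \<open>r\<close> would
satisfy \<open>r\<^sup>2 \<le> p\<close>, while \<open>r > F = 3 * (m + 1)\<close> and \<open>F\<^sup>2 > p\<close>.
\<close>

theorem prime_iff_witnesses:
  assumes "a \<ge> 1" "b \<ge> 1"
  shows "prime (p_of a b) \<longleftrightarrow>
    (\<exists>w2 w3 :: int. witness (p_of a b) 2 w2 \<and> witness (p_of a b) 3 w3)"
proof
  let ?p = "p_of a b" and ?m = "m_of a b"
  have gt: "?p > 1" using p_of_ge[OF assms] by simp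
  {
    assume "prime ?p"
    then obtain g where "ord ?p g = ?p - 1"
      using residue_prime_has_primroot[of ?p] by blast
    moreover have "2 dvd ?p - 1" "3 dvd ?p - 1"
      unfolding p_of_pred using assms by (auto simp: dvd_mult)
    ultimately show "\<exists>w2 w3. witness ?p 2 w2 \<and> witness ?p 3 w3"
      using certifies_of_primroot[OF \<open>prime ?p\<close>] witness_iff_certifies by (metis one_less_numeral_iff semiring_norm(76,77))
  }
  assume "\<exists>w2 w3. witness ?p 2 w2 \<and> witness ?p 3 w3"
  then obtain w2 w3 where w: "witness ?p 2 w2" "witness ?p 3 w3" by blast
  have "witness ?p \<nu> (int (nat (w mod int ?p))) \<longleftrightarrow> witness ?p \<nu> w" for \<nu> w
    using witness_mod gt by simp
  with w obtain v2 v3 where v: "certifies ?p (?p - 1) 2 v2" "certifies ?p (?p - 1) 3 v3"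
    by (metis witness_iff_certifies)
  have div: "2 ^ a * 3 ^ Suc b dvd r - 1" if "prime r" "r dvd ?p" for r
  proof (rule divides_mult)
    show "2 ^ a dvd r - 1"
      using certified_prime_power_dvd[of ?p "?m * 3 ^ Suc b" 2 a v2 r] v that
      unfolding p_of_pred by simp
    have "?p - 1 = ?m * 2 ^ a * 3 ^ Suc b" unfolding p_of_pred by simp
    then show "3 ^ Suc b dvd r - 1"
      using certified_prime_power_dvd[of ?p "?m * 2 ^ a" 3 "Suc b" v3 r] v that by simp
    show "coprime ((2::nat) ^ a) (3 ^ Suc b)" by simp
  qed
  show "prime ?p"
  proof (rule ccontr)
    assume "\<not> prime ?p"
    then obtain r where r: "prime r" "r dvd ?p" "r\<^sup>2 \<le> ?p"
      using prime_prime_factor_sqrt[of ?p] gt by auto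
    have "3 * Suc ?m dvd r - 1" using div[OF r(1,2)] m_of_bounds(2)[OF assms] by (simp add: mult_ac)
    then have "3 * Suc ?m \<le> r - 1" using prime_gt_1_nat[OF r(1)] by (intro dvd_imp_le) auto
    then have "(3 * Suc ?m)\<^sup>2 \<le> r\<^sup>2" by (intro power_mono) auto
    then show False using r(3) unfolding p_of_def by (simp add: power2_eq_square algebra_simps)
  qed
qed

section \<open>A Chebyshev bound\<close>

text \<open>
The recurrence of Leibniz' harmonic triangle; it is applied to \<open>A = n choose k\<close> and
\<open>C = n choose (k + 1)\<close> with \<open>x = n + 1\<close> and \<open>y = k + 1\<close>.
\<close>

lemma reciprocal_identity:
  fixes A C x y :: real
  assumes "y * C = (x - y) * A" "A > 0" "C > 0" "x > 0" "y > 0"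
  shows "1 / (x * C) = 1 / (y * C) - 1 / (x * A)"
  using assms by (simp add: field_simps)

text \<open>
The numbers \<open>1 / (k * (n choose k))\<close> form Leibniz' harmonic triangle. Its boundary entries are \<open>1 / n\<close>
and each inner entry is a difference of two entries with smaller \<open>n\<close> or \<open>k\<close>, so multiplication by a
common multiple of \<open>1, ..., n\<close> makes all of them integers.
\<close>

lemma mult_binomial_dvd_common_multiple:
  fixes L :: nat
  assumes "L > 0" "\<And>i. 1 \<le> i \<Longrightarrow> i \<le> n \<Longrightarrow> i dvd L" "1 \<le> k" "k \<le> n"
  shows "k * (n choose k) dvd L"
proof -
  have "real L / (real k * real (n choose k)) \<in> \<int>"
    using assms(2-)
  proof (induction n arbitrary: k)
    case (Suc n)
    note outer_IH = Suc.IH and outer_dvd = Suc.prems(1)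
    have inner: "k \<le> n \<Longrightarrow> real L / (real (Suc k) * real (Suc n choose Suc k)) \<in> \<int>" for k
    proof (induction k)
      case 0
      have "Suc n dvd L" using Suc.prems(1)[of "Suc n"] by simp
      then obtain q where "L = Suc n * q" ..
      then have "real L / (real (Suc n)) = real q" by (simp add: field_simps)
      then show ?case by simp
    next
      case (Suc k)
      have pos: "real (n choose k) > 0" "real (n choose Suc k) > 0"
        using Suc.prems by (simp_all add: zero_less_binomial)
      have id1: "real (Suc k) * real (Suc n choose Suc k) = real (Suc n) * real (n choose k)"
        using Suc_times_binomial[of k n] by (metis of_nat_mult)
      have id2: "real (Suc (Suc k)) * real (Suc n choose Suc (Suc k))
          = real (Suc n) * real (n choose Suc k)"
        using Suc_times_binomial[of "Suc k" n] by (metis of_nat_mult)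
      have "Suc k * (n choose Suc k) = (n - k) * (n choose k)"
        using binomial_absorb_comp[of n k] Suc_times_binomial_eq[of n k]
        by (metis binomial_absorption binomial_absorb_comp)
      then have "real (Suc k) * real (n choose Suc k) 
          = (real (Suc n) - real (Suc k)) * real (n choose k)"
        unfolding of_nat_diff[OF Suc_le_mono[THEN iffD2, OF Suc_leD[OF Suc.prems]], symmetric] diff_Suc_Suc
        using Suc.prems by (simp only: flip: of_nat_mult)
      then have "1 / (real (Suc n) * real (n choose Suc k))
          = 1 / (real (Suc k) * real (n choose Suc k)) - 1 / (real (Suc n) * real (n choose k))"
        by (rule reciprocal_identity[OF _ pos]) simp_all
      then have "real L / (real (Suc (Suc k)) * real (Suc n choose Suc (Suc k)))
          = real L / (real (Suc k) * real (n choose Suc k))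
            - real L / (real (Suc k) * real (Suc n choose Suc k))"
        unfolding id1 id2 by (metis (no_types, opaque_lifting) divide_inverse mult.right_neutral
            mult_1 right_diff_distrib)
      moreover have "real L / (real (Suc k) * real (n choose Suc k)) \<in> \<int>"
        using Suc.prems outer_dvd by (intro outer_IH) auto
      ultimately show ?case using Suc by simp
    qed
    show ?case using inner[of "k - 1"] Suc.prems by (cases k) auto
  qed simp
  then obtain z where z: "real L / (real k * real (n choose k)) = real_of_int z"
    by (auto elim: Ints_cases)
  have "real k * real (n choose k) > 0" using assms(3,4) by (simp add: zero_less_binomial)
  moreover have "x = y * c" if "x / c = y" "c > 0" for x y c :: real
    using that by (simp add: field_simps)
  ultimately have "real L = real_of_int z * (real k * real (n choose k))" using z by blast
  then have "real_of_int (int L) = real_of_int (z * int (k * (n choose k)))" by simp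
  then have "int L = z * int (k * (n choose k))" by (simp only: of_int_eq_iff)
  then have "int (k * (n choose k)) dvd int L" by simp
  then show ?thesis by (simp only: int_dvd_int_iff)
qed

definition primes_upto :: "nat \<Rightarrow> nat set" where
  "primes_upto n = {p. prime p \<and> p \<le> n}"

lemma finite_primes_upto [simp]: "finite (primes_upto n)"
  unfolding primes_upto_def by (rule finite_subset[of _ "{..n}"]) auto

text \<open>
The product of the largest prime powers not exceeding \<open>n\<close>, one for each prime: it has one factor
\<open>\<le> n\<close> for each of these primes.
\<close>

lemma common_multiple_le_power_prime_count:
  obtains L :: nat where "L > 0" "\<And>i. 1 \<le> i \<Longrightarrow> i \<le> n \<Longrightarrow> i dvd L"
    "L \<le> n ^ card (primes_upto n)"
proof
  let ?L = "\<Prod>p\<in>primes_upto n. p ^ (floorlog p n - 1)"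
  show pos: "?L > 0" by (intro prod_pos) (auto simp: primes_upto_def prime_gt_0_nat)
  show "i dvd ?L" if i: "1 \<le> i" "i \<le> n" for i
  proof (rule multiplicity_le_imp_dvd)
    fix p :: nat assume p: "prime p"
    define j where "j = multiplicity p i"
    have "p ^ j dvd i" unfolding j_def by (rule multiplicity_dvd)
    then have le: "p ^ j \<le> n" using i by (auto dest: dvd_imp_le)
    show "multiplicity p i \<le> multiplicity p ?L"
    proof (cases "j = 0")
      case False
      then have "p \<le> n" using le self_le_power[of p j] p prime_gt_0_nat[of p] by (auto intro: order_trans)
      then have "p \<in> primes_upto n" using p by (simp add: primes_upto_def)
      then have "p ^ (floorlog p n - 1) dvd ?L" by (intro dvd_prodI) auto
      moreover have "j \<le> floorlog p n - 1"
        using floorlog_ge_SucI[OF le] p prime_gt_1_nat[of p] by simp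
      ultimately have "p ^ j dvd ?L" using le_imp_power_dvd dvd_trans by blast
      then show ?thesis unfolding j_def using p pos
        by (intro multiplicity_geI) (auto simp: not_prime_unit)
    qed (simp add: j_def)
  qed (use i in auto)
  have "?L \<le> (\<Prod>p\<in>primes_upto n. n)"
  proof (rule prod_mono)
    fix p assume "p \<in> primes_upto n"
    then have "p > 1" "n > 0" using prime_gt_1_nat[of p] by (auto simp: primes_upto_def)
    then show "0 \<le> p ^ (floorlog p n - 1) \<and> p ^ (floorlog p n - 1) \<le> n"
      using floorlog_bounds[of n p] by simp
  qed
  then show "?L \<le> n ^ card (primes_upto n)" by simp
qed

text \<open>
With \<open>2 * n = 2 ^ j\<close>, the central binomial coefficient \<open>2 * n choose n\<close> is at least \<open>2 ^ n\<close> and divides a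
common multiple of \<open>1, ..., 2 * n\<close> that is at most \<open>(2 * n)\<close> to the number of primes up to \<open>2 * n\<close>.
\<close>

lemma prime_count_power2:
  assumes "j \<ge> 1"
  shows "2 ^ j \<le> 2 * j * card (primes_upto (2 ^ j))"
proof -
  define n :: nat where "n = 2 ^ (j - 1)"
  have n: "n \<ge> 1" "2 * n = 2 ^ j" using assms unfolding n_def by (simp_all flip: power_Suc)
  obtain L :: nat where L: "L > 0" "\<And>i. 1 \<le> i \<Longrightarrow> i \<le> 2 * n \<Longrightarrow> i dvd L"
    "L \<le> (2 * n) ^ card (primes_upto (2 * n))"
    using common_multiple_le_power_prime_count[of "2 * n"] by blast
  have "real (2 ^ n) \<le> 4 ^ n / (2 * real n)"
  proof -
    have "2 * n \<le> 2 ^ n"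
    proof -
      have "Suc (n - 1) \<le> 2 ^ (n - 1)" by (rule Suc_leI, rule less_exp)
      then have "2 * n \<le> 2 * 2 ^ (n - 1)" using n(1) by simp
      then show ?thesis using n(1) by (simp flip: power_Suc)
    qed
    then have "real (2 * n) \<le> 2 ^ n" by (metis of_nat_le_iff of_nat_numeral of_nat_power)
    then have "2 ^ n * real (2 * n) \<le> 2 ^ n * 2 ^ n" by (intro mult_left_mono) auto
    also have "\<dots> = (4::real) ^ n" by (simp flip: power_mult_distrib)
    finally show ?thesis using n(1) by (simp add: field_simps)
  qed
  also have "\<dots> \<le> real (2 * n choose n)" using central_binomial_lower_bound[of n] n by simp
  finally have "2 ^ n \<le> 2 * n choose n" by (simp only: of_nat_le_iff)
  also have "2 * n choose n \<le> n * (2 * n choose n)" using n by simp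
  also have "\<dots> \<le> L"
    using mult_binomial_dvd_common_multiple[OF L(1,2) n(1)] L(1) by (intro dvd_imp_le) auto
  also have "\<dots> \<le> 2 ^ (j * card (primes_upto (2 ^ j)))"
    using L(3) unfolding n(2) by (simp add: power_mult)
  finally have "n \<le> j * card (primes_upto (2 ^ j))"
    by (simp add: power_increasing_iff)
  then show ?thesis using n(2) by simp
qed

section \<open>Exponents annihilating all small residues\<close>

text \<open>
The products of \<open>u\<close> distinct primes up to \<open>B\<close> are pairwise distinct residues modulo \<open>n\<close> by unique
factorization, and all of them are roots of the polynomial \<open>x ^ e - 1\<close>, which has at most \<open>e\<close> roots in
the field of \<open>n\<close> elements.
\<close>

lemma binomial_le_exponent:
  assumes "prime n" "e > 0" "\<And>w. 1 \<le> w \<Longrightarrow> w \<le> B \<Longrightarrow> [w ^ e = 1] (mod n)" "B ^ u < n"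
  shows "card (primes_upto B) choose u \<le> e"
proof -
  define \<S> where "\<S> = {T. T \<subseteq> primes_upto B \<and> card T = u}"
  have T: "finite T" "\<And>p. p \<in> T \<Longrightarrow> prime p \<and> p \<le> B" "card T = u" if "T \<in> \<S>" for T
    using that finite_subset[OF _ finite_primes_upto] unfolding \<S>_def primes_upto_def by auto
  have "prime_factors (\<Prod>T) = T" if "T \<in> \<S>" for T
  proof -
    have "0 \<notin> T" using T(2)[OF that, of 0] not_prime_0 by blast
    then have "prime_factors (\<Prod>T) = (\<Union>p\<in>T. prime_factors p)"
      using prime_factors_prod[of T "\<lambda>p. p"] T(1)[OF that] by simp
    also have "\<dots> = (\<Union>p\<in>T. {p})"
      using T(2)[OF that] by (intro SUP_cong) (auto simp: prime_prime_factors)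
    finally show ?thesis by simp
  qed
  then have "inj_on (\<lambda>T. \<Prod>T) \<S>" by (metis inj_onI)
  moreover have "(\<lambda>T. \<Prod>T) ` \<S> \<subseteq> {x \<in> {..<n}. [x ^ e = 1] (mod n)}"
  proof clarify
    fix T assume "T \<in> \<S>"
    note T = T[OF this]
    have "\<Prod>T \<le> (\<Prod>p\<in>T. B)" using T by (intro prod_mono) auto
    then have "\<Prod>T < n" using T assms(4) by simp
    moreover have "[(\<Prod>p\<in>T. p ^ e) = (\<Prod>p\<in>T. 1)] (mod n)"
      using T assms(3) prime_ge_1_nat by (intro cong_prod) auto
    ultimately show "\<Prod>T \<in> {..<n} \<and> [(\<Prod>T) ^ e = 1] (mod n)"
      by (simp add: prod_power_distrib)
  qed
  ultimately have "card \<S> \<le> card {x \<in> {..<n}. [x ^ e = 1] (mod n)}"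
    by (rule card_inj_on_le) simp
  also have "\<dots> \<le> e" using roots_mod_prime_bound[OF assms(1,2)] .
  finally show ?thesis unfolding \<S>_def by (simp add: n_subsets)
qed

text \<open>
Let \<open>h\<close> be the integral part of the binary logarithm of \<open>n - 1\<close> and let \<open>2 ^ t\<close> be the power of 2
between \<open>l\<close> and \<open>2 * l\<close>. For \<open>B = 2 ^ (24 * t)\<close>, the Chebyshev bound gives at least
\<open>u * 2 ^ (22 * t)\<close> primes up to \<open>B\<close>, where \<open>u = h div (24 * t)\<close> is the number of factors that fit below
\<open>n\<close>. So the previous lemma yields \<open>e \<ge> 2 ^ (22 * t * u)\<close>, about \<open>n\<close> to the power 11/12. Replacing 11/12
by 5/6 leaves room for the rounding in \<open>u\<close> provided that \<open>h + 1 \<ge> 264 * t\<close>. For the remaining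
\<open>n\<close>, the bound \<open>W\<close> is at least \<open>n\<close>, so that all nonzero residues are annihilated.
\<close>

lemma small_residues_exponent_bound:
  assumes n: "prime n" "n > 64" "n \<le> 2 ^ l" and "e > 0"
    and W: "W \<ge> (2 * l) ^ 264"
    and w: "\<And>w. 1 \<le> w \<Longrightarrow> w \<le> min W (n - 1) \<Longrightarrow> [w ^ e = 1] (mod n)"
  shows "n ^ 5 \<le> e ^ 6"
proof -
  define h where "h = floorlog 2 (n - 1) - 1"
  have fl: "floorlog 2 (n - 1) \<ge> 7" using n by (intro floorlog_geI) auto
  have lo: "2 ^ h \<le> n - 1" and "n - 1 < 2 ^ Suc h"
    using floorlog_bounds[of "n - 1" 2] n fl unfolding h_def by auto
  then have hi: "n \<le> 2 ^ Suc h" by simp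
  have "(2::nat) ^ h < 2 ^ l" using lo n by linarith
  then have "h < l" by simp
  have h6: "h \<ge> 6" using fl unfolding h_def by simp
  have n5: "n ^ 5 \<le> 2 ^ (5 * Suc h)"
    using power_mono[OF hi, of 5] by (simp only: mult.commute[of 5] power_mult zero_le)
  define t where "t = ceillog2 l"
  have t: "l \<le> 2 ^ t" "2 ^ t < 2 * l"
    using le_two_power_ceillog2 two_power_ceillog2_gt \<open>h < l\<close> unfolding t_def by auto
  have "t \<noteq> 0" using t(1) \<open>h < l\<close> h6 by (cases t) auto
  have W': "2 ^ (264 * t) \<le> W"
  proof -
    have "(2::nat) ^ (264 * t) = (2 ^ t) ^ 264" by (simp add: power_mult mult.commute flip: power_mult)
    also have "\<dots> \<le> (2 * l) ^ 264" using t(2) by (intro power_mono) auto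
    finally show ?thesis using W by simp
  qed
  show ?thesis
  proof (cases "Suc h < 264 * t")
    case True
    \<comment> \<open>Here \<open>W \<ge> n\<close>, so all of \<open>1, ..., n - 1\<close> are roots of \<open>x ^ e = 1\<close>.\<close>
    then have "(2::nat) ^ Suc h \<le> 2 ^ (264 * t)" by (intro power_increasing) auto
    then have "n \<le> W" using hi W' by linarith
    have "{1..n - 1} \<subseteq> {x \<in> {..<n}. [x ^ e = 1] (mod n)}"
      using w \<open>n \<le> W\<close> n(2) by auto
    then have "card {1..n - 1} \<le> card {x \<in> {..<n}. [x ^ e = 1] (mod n)}"
      by (intro card_mono) auto
    also have "\<dots> \<le> e" using roots_mod_prime_bound[OF n(1) \<open>e > 0\<close>] .
    finally have "2 ^ h \<le> e" using lo by simp
    then have "(2 ^ h) ^ 6 \<le> e ^ 6" by (intro power_mono) auto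
    moreover have "(2::nat) ^ (5 * Suc h) \<le> 2 ^ (h * 6)" using h6 by (intro power_increasing) auto
    ultimately show ?thesis using n5 unfolding power_mult[of 2 h 6] by linarith
  next
    case False
    define u where "u = h div (24 * t)"
    define B :: nat where "B = 2 ^ (24 * t)"
    define \<pi> where "\<pi> = card (primes_upto B)"
    have u: "24 * t * u \<le> h" "Suc h \<le> 24 * t * Suc u"
    proof -
      show "24 * t * u \<le> h" unfolding u_def by (rule times_div_less_eq_dividend)
      have "h < 24 * t + 24 * t * u"
        unfolding u_def using \<open>t \<noteq> 0\<close> by (intro dividend_less_times_div) simp
      then show "Suc h \<le> 24 * t * Suc u" by simp
    qed
    have "(2::nat) ^ (24 * t) \<le> 2 ^ h" "(2::nat) ^ (24 * t) \<le> 2 ^ (264 * t)"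
      using False \<open>t \<noteq> 0\<close> by (auto intro!: power_increasing)
    then have B: "B \<le> min W (n - 1)" using lo W' unfolding B_def by linarith
    have "B ^ u = 2 ^ (24 * t * u)" unfolding B_def by (simp only: power_mult)
    also have "\<dots> \<le> 2 ^ h" using u by (intro power_increasing) auto
    finally have "B ^ u < n" using lo n by linarith
    have cnt: "\<pi> choose u \<le> e" unfolding \<pi>_def
      using binomial_le_exponent[OF n(1) \<open>e > 0\<close> _ \<open>B ^ u < n\<close>] w B by simp
    \<comment> \<open>The denominator \<open>24 * t\<close> of the Chebyshev bound cancels against the one in \<open>u\<close>.\<close>
    have "u * 2 ^ (22 * t) \<le> \<pi>"
    proof -
      have "24 * t * u \<le> 2 ^ t" using u t \<open>h < l\<close> by linarith
      then have "2 * (24 * t) * (u * 2 ^ (22 * t)) \<le> 2 * 2 ^ t * 2 ^ (22 * t)"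
        using mult_right_mono[of "24 * t * u" "2 ^ t" "2 * 2 ^ (22 * t)"] by (simp add: mult_ac)
      also have "\<dots> = (2::nat) ^ (1 + t + 22 * t)" by (simp only: power_add power_one_right)
      also have "\<dots> \<le> B" unfolding B_def using \<open>t \<noteq> 0\<close> by (intro power_increasing) auto
      also have "\<dots> \<le> 2 * (24 * t) * \<pi>"
        using prime_count_power2[of "24 * t"] \<open>t \<noteq> 0\<close> unfolding B_def \<pi>_def by simp
      finally show ?thesis using \<open>t \<noteq> 0\<close> by simp
    qed
    have "2 ^ (22 * t * u) \<le> e"
    proof (cases "u = 0")
      case True then show ?thesis using \<open>e > 0\<close> by simp
    next
      case u0: False
      have "real u * 2 ^ (22 * t) \<le> real \<pi>"
        using \<open>u * 2 ^ (22 * t) \<le> \<pi>\<close> by (metis of_nat_le_iff of_nat_mult of_nat_numeral of_nat_power)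
      then have "2 ^ (22 * t) \<le> real \<pi> / real u" using u0 by (simp add: field_simps)
      then have "(2 ^ (22 * t)) ^ u \<le> (real \<pi> / real u) ^ u" by (intro power_mono) auto
      also have "u \<le> \<pi>" using \<open>u * 2 ^ (22 * t) \<le> \<pi>\<close> by (rule order_trans[rotated]) simp
      then have "(real \<pi> / real u) ^ u \<le> real (\<pi> choose u)" by (rule binomial_ge_n_over_k_pow_k)
      finally have "real (2 ^ (22 * t * u)) \<le> real (\<pi> choose u)" by (simp add: power_mult)
      then show ?thesis using cnt by linarith
    qed
    then have "(2 ^ (22 * t * u)) ^ 6 \<le> e ^ 6" by (intro power_mono) auto
    moreover have "(2::nat) ^ (5 * Suc h) \<le> 2 ^ (22 * t * u * 6)"
      using u(2) False by (intro power_increasing) (auto simp: algebra_simps)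
    ultimately show ?thesis using n5 unfolding power_mult[of 2 "22 * t * u" 6] by linarith
  qed
qed

text \<open>
As \<open>m\<^sup>2 < n\<close>, the assumption \<open>E ^ 3 \<le> n\<close> would give \<open>(m * E) ^ 6 = (m\<^sup>2) ^ 3 * (E ^ 3)\<^sup>2 < n ^ 5\<close>.
\<close>

lemma cube_gt_of_exponent_bound:
  fixes m E n :: nat
  assumes "n = 3 * m * (m + 1) + 1" "m \<ge> 1" "n ^ 5 \<le> (m * E) ^ 6"
  shows "n < E ^ 3"
proof (rule ccontr)
  assume "\<not> ?thesis"
  then have "(E ^ 3)\<^sup>2 \<le> n\<^sup>2" by (intro power_mono) auto
  moreover have "(m\<^sup>2) ^ 3 < n ^ 3"
    using assms by (intro power_strict_mono) (auto simp: power2_eq_square algebra_simps)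
  moreover have "n\<^sup>2 > 0" using assms(1) by simp
  ultimately have "(m\<^sup>2) ^ 3 * (E ^ 3)\<^sup>2 < n ^ 3 * n\<^sup>2"
    by (meson le_less_trans mult_le_mono2 mult_less_mono1)
  then have "(m * E) ^ 6 < n ^ 5"
    by (simp add: power_mult_distrib flip: power_mult power_add)
  then show False using assms(3) by simp
qed

section \<open>Divisors in a residue class modulo a cube root\<close>

lemma divisor_cong_1:
  fixes n d E :: nat
  assumes "\<And>r. prime r \<Longrightarrow> r dvd n \<Longrightarrow> E dvd r - 1" "d dvd n" "d > 0"
  shows "[d = 1] (mod E)"
  using assms(2,3)
proof (induction d rule: prime_divisors_induct)
  case (factor p x)
  have "prime p" using factor by simp
  have "E dvd p - 1" using assms(1)[OF \<open>prime p\<close>] factor.prems by (metis dvd_mult_left)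
  then have "[p = 1] (mod E)" using prime_ge_1_nat[OF \<open>prime p\<close>] by (metis cong_altdef_nat cong_sym)
  moreover have "[x = 1] (mod E)" using factor by (metis dvd_mult_right mult_pos_pos nat_0_less_mult_iff)
  ultimately show ?case using cong_mult by fastforce
qed auto

text \<open>
A composite \<open>n\<close> is \<open>(1 + x * E) * (1 + y * E)\<close> with \<open>x \<ge> y \<ge> 1\<close>, hence
\<open>(n - 1) div E = x * y * E + (x + y)\<close>. Since \<open>n < E ^ 3\<close>, both \<open>x * y\<close> and \<open>x + y\<close> are smaller than \<open>E\<close>, so
they are the digits \<open>c1\<close> and \<open>c0\<close>. The discriminant \<open>c0\<^sup>2 - 4 * c1\<close> is \<open>(x - y)\<^sup>2\<close>, its root \<open>s\<close> is
\<open>x - y\<close>, and \<open>(c0 + s) div 2\<close> is \<open>x\<close>.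
\<close>

lemma composite_divisor_formula:
  fixes n E s :: nat
  defines "c0 \<equiv> (n - 1) div E mod E" and "c1 \<equiv> (n - 1) div E div E"
  assumes div: "\<And>r. prime r \<Longrightarrow> r dvd n \<Longrightarrow> E dvd r - 1" and "n < E ^ 3" "n > 1" "\<not> prime n"
    and s: "s\<^sup>2 \<le> c0\<^sup>2 - 4 * c1" "c0\<^sup>2 - 4 * c1 < (Suc s)\<^sup>2"
  defines "q \<equiv> 1 + (c0 + s) div 2 * E"
  shows "1 < q" "q < n" "q dvd n"
proof -
  have "E \<noteq> 0" using \<open>n < E ^ 3\<close> by (cases "E = 0") auto
  obtain r where r: "prime r" "r dvd n" using \<open>n > 1\<close> prime_factor_nat[of n] by auto
  then obtain r' where rr: "n = r * r'" by (auto elim: dvdE)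
  have cong: "\<exists>x\<ge>1. d = 1 + x * E" if "d dvd n" "d > 1" for d
  proof -
    have "[d = 1] (mod E)" using divisor_cong_1[OF div] that by simp
    then have "E dvd d - 1" using that by (simp add: cong_altdef_nat)
    then obtain x where "d - 1 = E * x" ..
    then show ?thesis using that by (intro exI[of _ x]) (cases x, auto simp: mult.commute)
  qed
  have "r > 1" using prime_gt_1_nat r(1) .
  moreover have "r' > 1" using rr r(1) \<open>\<not> prime n\<close> \<open>n > 1\<close> by (cases "r' = 0"; cases "r' = 1") auto
  moreover have "r dvd n" "r' dvd n" using rr by auto
  ultimately obtain x' y' where "x' \<ge> 1" "y' \<ge> 1" "n = (1 + x' * E) * (1 + y' * E)"
    using cong rr by metis
  then obtain x y where xy: "y \<ge> 1" "x \<ge> y" and n: "n = (1 + x * E) * (1 + y * E)"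
    by (metis linear mult.commute)
  have n': "n = x * y * E\<^sup>2 + (x + y) * E + 1"
    unfolding n by (simp add: algebra_simps power2_eq_square)
  have le: "x + y \<le> x * y + 1"
  proof -
    obtain x1 y1 where "x = Suc x1" "y = Suc y1" using xy by (metis One_nat_def Suc_le_D le_trans)
    then show ?thesis by simp
  qed
  have "x * y < E"
  proof (rule ccontr)
    assume "\<not> ?thesis"
    then have "E * E\<^sup>2 \<le> x * y * E\<^sup>2" by (intro mult_right_mono) auto
    moreover have "E * E\<^sup>2 = E ^ 3" by (simp add: power3_eq_cube power2_eq_square)
    ultimately show False using n' \<open>n < E ^ 3\<close> by linarith
  qed
  \<comment> \<open>In the extreme case \<open>x * y = E - 1\<close> and \<open>x + y = E\<close>, the product \<open>n\<close> would be \<open>E ^ 3 + 1\<close>.\<close>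
  have "x + y < E"
  proof (rule ccontr)
    assume "\<not> ?thesis"
    then have 1: "x + y = E" "x * y = E - 1" using le \<open>x * y < E\<close> by linarith+
    have "(E - 1) * E\<^sup>2 + E * E = E ^ 3"
      using \<open>E \<noteq> 0\<close> by (cases E) (auto simp: power2_eq_square power3_eq_cube algebra_simps)
    then show False using n' \<open>n < E ^ 3\<close> unfolding 1 by simp
  qed
  have "n - 1 = (x * y * E + (x + y)) * E" unfolding n' by (simp add: algebra_simps power2_eq_square)
  then have c: "(n - 1) div E = x * y * E + (x + y)" using \<open>E \<noteq> 0\<close> by simp
  then have c0: "c0 = x + y" and c1: "c1 = x * y"
    unfolding c0_def c1_def c using \<open>x + y < E\<close> by auto
  have "c0\<^sup>2 - 4 * c1 = (x - y)\<^sup>2"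
  proof -
    obtain k where "x = y + k" using xy(2) le_Suc_ex by blast
    then show ?thesis unfolding c0 c1 by (simp add: power2_eq_square algebra_simps)
  qed
  then have "s\<^sup>2 \<le> (x - y)\<^sup>2" "(x - y)\<^sup>2 < (Suc s)\<^sup>2" using s by auto
  then have "s \<le> x - y" "x - y < Suc s"
    using power2_le_imp_le power_less_imp_less_base by blast+
  then have "s = x - y" by simp
  then have "(c0 + s) div 2 = x" unfolding c0 using xy(2) by simp
  then have q: "q = 1 + x * E" unfolding q_def by simp
  show "1 < q" unfolding q using xy \<open>E \<noteq> 0\<close> by simp
  show "q dvd n" unfolding n q by (rule dvd_triv_left)
  have "(1 + x * E) * 1 < (1 + x * E) * (1 + y * E)"
    using xy \<open>E \<noteq> 0\<close> by (intro mult_strict_left_mono) auto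
  then show "q < n" unfolding n q by simp
qed

section \<open>A cost calculus for programs with bounded values\<close>

fun nodes :: "aexp \<Rightarrow> nat" where
  "nodes (Num n) = 1"
| "nodes (Reg r) = 1"
| "nodes (Bin f e1 e2) = nodes e1 + nodes e2 + 1"

text \<open>
Every intermediate result counts, as a large intermediate value is expensive even if the final
value is small.
\<close>

fun fits :: "nat \<Rightarrow> aexp \<Rightarrow> state \<Rightarrow> bool" where
  "fits M (Num n) s \<longleftrightarrow> n \<le> M"
| "fits M (Reg r) s \<longleftrightarrow> s r \<le> M"
| "fits M (Bin f e1 e2) s \<longleftrightarrow>
     fits M e1 s \<and> fits M e2 s \<and> apply_op f (aval e1 s) (aval e2 s) \<le> M"

text \<open>
The limit on the size of an expression turns the cost of its evaluation into a quantity \<open>tick M\<close>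
that depends on the value bound alone. It has to accommodate the 264-fold product in
\<open>setup_bound\<close>.
\<close>

definition cheap :: "nat \<Rightarrow> aexp \<Rightarrow> state \<Rightarrow> bool" where
  "cheap M e s \<longleftrightarrow> fits M e s \<and> nodes e \<le> 1000"

definition tick :: "nat \<Rightarrow> nat" where
  "tick M = 1 + 1000 * (1 + floorlog 2 M)\<^sup>2"

text \<open>
A total-correctness judgement with \<open>k\<close> credits of \<open>tick M\<close> bit operations each: from \<open>s\<close>, the program
terminates within that budget in a state satisfying \<open>Q\<close>.
\<close>

definition runs :: "nat \<Rightarrow> nat \<Rightarrow> com \<Rightarrow> (state \<Rightarrow> bool) \<Rightarrow> state \<Rightarrow> bool" where
  "runs M k c Q s \<longleftrightarrow> (\<exists>t s'. exec c s t s' \<and> t \<le> k * tick M \<and> Q s')"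

lemma fits_aval: "fits M e s \<Longrightarrow> aval e s \<le> M"
  by (cases e) auto

lemma acost_le: "fits M e s \<Longrightarrow> acost e s \<le> nodes e * (1 + floorlog 2 M)\<^sup>2"
proof (induction e)
  case (Bin f e1 e2)
  then have "aval e1 s \<le> M" "aval e2 s \<le> M" by (auto intro: fits_aval)
  then have "(1 + floorlog 2 (aval e1 s)) * (1 + floorlog 2 (aval e2 s)) \<le> (1 + floorlog 2 M)\<^sup>2"
    unfolding power2_eq_square by (intro mult_mono) (auto intro: floorlog_mono)
  with Bin show ?case by (simp add: distrib_right)
qed (auto simp: power2_eq_square intro: floorlog_mono order_trans[of _ "floorlog 2 M"])

lemma cheap_acost: "cheap M e s \<Longrightarrow> 1 + acost e s \<le> tick M"
  unfolding cheap_def tick_def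
  by (metis acost_le add_le_cancel_left mult_le_mono1 order_trans)

lemma runs_mono:
  "runs M k c Q s \<Longrightarrow> k \<le> k' \<Longrightarrow> (\<And>s'. Q s' \<Longrightarrow> Q' s') \<Longrightarrow> runs M k' c Q' s"
  unfolding runs_def by (meson mult_le_mono1 order_trans)

lemma runs_Skip: "1 \<le> k \<Longrightarrow> Q s \<Longrightarrow> runs M k Skip Q s"
  unfolding runs_def tick_def by (intro exI[of _ 1] exI[of _ s]) (use exec.Skip[of s] in auto)

lemma runs_Assign:
  assumes "1 \<le> k" "cheap M e s" "Q (s(r := aval e s))"
  shows "runs M k (Assign r e) Q s"
proof -
  have "1 + acost e s \<le> k * tick M"
    using cheap_acost[OF assms(2)] mult_le_mono1[OF assms(1), of "tick M"] by linarith
  then show ?thesis unfolding runs_def using exec.Assign assms(3) by blast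
qed

lemma runs_Seq:
  assumes "k1 \<le> k" "runs M k1 c1 (\<lambda>s'. runs M (k - k1) c2 Q s') s"
  shows "runs M k (Seq c1 c2) Q s"
proof -
  obtain t1 s1 t2 s2 where *: "exec c1 s t1 s1" "t1 \<le> k1 * tick M"
    "exec c2 s1 t2 s2" "t2 \<le> (k - k1) * tick M" "Q s2"
    using assms(2) unfolding runs_def by blast
  have "k1 * tick M + (k - k1) * tick M = k * tick M"
    using assms(1) by (simp flip: distrib_right)
  then have "t1 + t2 \<le> k * tick M" using * by linarith
  then show ?thesis unfolding runs_def using exec.Seq[OF *(1,3)] *(5) by blast
qed

text \<open>
Composition by specification: what the first program establishes is all that the second may use.
\<close>

lemma runs_call:
  assumes "runs M k1 c1 R s" "k1 \<le> k" "\<And>s'. R s' \<Longrightarrow> runs M (k - k1) c2 Q s'"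
  shows "runs M k (Seq c1 c2) Q s"
  using assms by (intro runs_Seq[of k1] runs_mono[OF assms(1)]) auto

lemma runs_Seq_Assign:
  assumes "1 \<le> k" "cheap M e s" "runs M (k - 1) c Q (s(r := aval e s))"
  shows "runs M k (Seq (Assign r e) c) Q s"
  by (rule runs_Seq[where ?k1.0 = 1]) (use assms in \<open>auto intro: runs_Assign\<close>)

lemma runs_If:
  assumes "1 \<le> k" "cheap M e s"
    "aval e s \<noteq> 0 \<Longrightarrow> runs M (k - 1) c1 Q s" "aval e s = 0 \<Longrightarrow> runs M (k - 1) c2 Q s"
  shows "runs M k (If e c1 c2) Q s"
proof -
  have *: "tick M + (k - 1) * tick M = k * tick M" using assms(1) by (cases k) auto
  note cost = cheap_acost[OF assms(2)]
  show ?thesis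
  proof (cases "aval e s = 0")
    case True
    then obtain t s' where e: "exec c2 s t s'" "t \<le> (k - 1) * tick M" "Q s'"
      using assms(4) unfolding runs_def by blast
    have "1 + acost e s + t \<le> k * tick M" using * cost e(2) by linarith
    then show ?thesis unfolding runs_def using exec.IfFalse[OF True e(1)] e(3) by blast
  next
    case False
    then obtain t s' where e: "exec c1 s t s'" "t \<le> (k - 1) * tick M" "Q s'"
      using assms(3) unfolding runs_def by blast
    have "1 + acost e s + t \<le> k * tick M" using * cost e(2) by linarith
    then show ?thesis unfolding runs_def using exec.IfTrue[OF False e(1)] e(3) by blast
  qed
qed

text \<open>
The continuation is moved into the branches, so that straight-line code with conditionals can be
executed symbolically by backward chaining.
\<close>

lemma runs_Seq_If:
  assumes "1 \<le> k" "cheap M e s"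
    "aval e s \<noteq> 0 \<Longrightarrow> runs M (k - 1) (Seq c1 c) Q s"
    "aval e s = 0 \<Longrightarrow> runs M (k - 1) (Seq c2 c) Q s"
  shows "runs M k (Seq (If e c1 c2) c) Q s"
proof -
  have *: "tick M + (k - 1) * tick M = k * tick M" using assms(1) by (cases k) auto
  note cost = cheap_acost[OF assms(2)]
  show ?thesis
  proof (cases "aval e s = 0")
    case True
    then obtain t s' where e: "exec (Seq c2 c) s t s'" "t \<le> (k - 1) * tick M" "Q s'"
      using assms(4) unfolding runs_def by blast
    then obtain t1 s1 t2 where 2: "t = t1 + t2" "exec c2 s t1 s1" "exec c s1 t2 s'" by (blast elim: SeqE)
    have "1 + acost e s + t1 + t2 \<le> k * tick M" using * cost e(2) 2(1) by linarith
    then show ?thesis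
      unfolding runs_def using exec.Seq[OF exec.IfFalse[OF True 2(2)] 2(3)] e(3) by blast
  next
    case False
    then obtain t s' where e: "exec (Seq c1 c) s t s'" "t \<le> (k - 1) * tick M" "Q s'"
      using assms(3) unfolding runs_def by blast
    then obtain t1 s1 t2 where 2: "t = t1 + t2" "exec c1 s t1 s1" "exec c s1 t2 s'" by (blast elim: SeqE)
    have "1 + acost e s + t1 + t2 \<le> k * tick M" using * cost e(2) 2(1) by linarith
    then show ?thesis
      unfolding runs_def using exec.Seq[OF exec.IfTrue[OF False 2(2)] 2(3)] e(3) by blast
  qed
qed

lemma runs_Seq_Skip: "1 \<le> k \<Longrightarrow> runs M (k - 1) c Q s \<Longrightarrow> runs M k (Seq Skip c) Q s"
  by (rule runs_Seq[where ?k1.0 = 1]) (auto intro: runs_Skip)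

lemmas runs_straight =
  runs_Seq_Assign runs_Seq_If runs_Seq_Skip runs_Assign runs_If runs_Skip

text \<open>
The variant \<open>f\<close> bounds the number of iterations, each of which pays \<open>k\<close> for the body and 1 for the
guard; the last credit is for the final test of the guard.
\<close>

lemma runs_While:
  assumes body: "\<And>s. I s \<Longrightarrow> aval g s \<noteq> 0 \<Longrightarrow> runs M k c (\<lambda>s'. I s' \<and> f s' < f s) s"
    and guard: "\<And>s. I s \<Longrightarrow> cheap M g s"
    and init: "I s" "f s \<le> N"
  shows "runs M ((k + 1) * N + 1) (While g c) (\<lambda>s'. I s' \<and> aval g s' = 0) s"
  using init
proof (induction N arbitrary: s rule: less_induct)
  case (less N)
  note cost = cheap_acost[OF guard[OF less.prems(1)]]
  show ?case
  proof (cases "aval g s = 0")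
    case True
    have "1 + acost g s \<le> ((k + 1) * N + 1) * tick M" using cost by simp
    then show ?thesis
      unfolding runs_def using exec.WhileFalse[OF True] True less.prems(1) by blast
  next
    case False
    obtain t1 s1 where 1: "exec c s t1 s1" "t1 \<le> k * tick M" "I s1" "f s1 < f s"
      using body[OF less.prems(1) False] unfolding runs_def by blast
    then obtain N' where N: "N = Suc N'" "f s1 \<le> N'" using less.prems(2) by (cases N) auto
    obtain t2 s2 where 2: "exec (While g c) s1 t2 s2" "t2 \<le> ((k + 1) * N' + 1) * tick M"
      "I s2" "aval g s2 = 0"
      using less.IH[of N' s1] 1(3) N unfolding runs_def by auto
    have "1 + acost g s + t1 + t2 \<le> tick M + k * tick M + ((k + 1) * N' + 1) * tick M"
      using cost 1(2) 2(2) by linarith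
    also have "\<dots> = ((k + 1) * N + 1) * tick M" unfolding N by (simp add: algebra_simps)
    finally show ?thesis
      unfolding runs_def using exec.WhileTrue[OF False 1(1) 2(1)] 2(3,4) by blast
  qed
qed

lemma bound_simps:
  fixes x y M :: nat
  shows "x \<le> M \<Longrightarrow> x div y \<le> M" "x \<le> M \<Longrightarrow> x mod y \<le> M" "x \<le> M \<Longrightarrow> x - y \<le> M"
  using div_le_dividend mod_less_eq_dividend order_trans by (blast, blast, simp)

text \<open>
Frame conditions: \<open>X\<close> contains the registers that a program may overwrite.

The programs below share one assignment of registers. Registers 0 to 3 hold the inputs and register
0 also the answer; 4 and 5 hold \<open>m\<close> and the modulus \<open>n\<close>; 6, 7 and 8 hold the exponent \<open>e\<close>, the prime
\<open>\<nu>\<close> and the base \<open>w\<close> of a certificate; 9 to 16 are work space for testing a certificate, with the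
result in 16; 17 and 18 are flags; 19 is the bound of the search for certificates; registers from 20
on hold auxiliary values for computing this bound and for the concluding divisor test.
\<close>

definition agree_except :: "nat set \<Rightarrow> state \<Rightarrow> state \<Rightarrow> bool" where
  "agree_except X s s' \<longleftrightarrow> (\<forall>r. r \<notin> X \<longrightarrow> s' r = s r)"

lemma agree_exceptD: "agree_except X s s' \<Longrightarrow> r \<notin> X \<Longrightarrow> s' r = s r"
  unfolding agree_except_def by blast

lemma agree_except_refl [simp]: "agree_except X s s"
  unfolding agree_except_def by blast

lemma agree_except_upd [simp]: "agree_except X s s' \<Longrightarrow> r \<in> X \<Longrightarrow> agree_except X s (s'(r := v))"
  unfolding agree_except_def by auto

text \<open>
Halving a positive quantity removes a binary digit; this is what makes the number of digits a loop
variant with logarithmically many iterations.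
\<close>

lemma floorlog_halve: "2 * x \<le> y \<Longrightarrow> y > 0 \<Longrightarrow> floorlog 2 x < floorlog 2 y"
proof -
  assume "2 * x \<le> y" "y > 0"
  then have "floorlog 2 x \<le> floorlog 2 (y div 2)" by (intro floorlog_mono) simp
  also have "\<dots> < floorlog 2 y" using \<open>y > 0\<close> by (subst (2) compute_floorlog) simp
  finally show ?thesis .
qed

section \<open>Programs for testing certificates\<close>

definition modpow_step :: com where
  "modpow_step = Seq (If (Bin binop.Mod (Reg 10) (Num 2))
         (Assign 11 (Bin binop.Mod (Bin Mul (Reg 11) (Reg 9)) (Reg 5))) Skip)
     (Seq (Assign 9 (Bin binop.Mod (Bin Mul (Reg 9) (Reg 9)) (Reg 5)))
       (Assign 10 (Bin Div (Reg 10) (Num 2))))"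

definition modpow :: com where
  "modpow = Seq (Assign 11 (Num 1)) (While (Reg 10) modpow_step)"

text \<open>
Repeated squaring: \<open>r11 * r9 ^ r10\<close> is invariant modulo \<open>n\<close>, where \<open>rj\<close> is the content of register \<open>j\<close>.
\<close>

lemma runs_modpow:
  assumes n: "s 5 = n" "n > 1" "n * n \<le> M" and "s 9 < n" "s 10 \<le> M"
  shows "runs M (5 * floorlog 2 (s 10) + 2) modpow
    (\<lambda>s'. s' 11 = s 9 ^ s 10 mod n \<and> agree_except {9,10,11} s s') s"
proof -
  define I where "I = (\<lambda>s'. agree_except {9,10,11} s s' \<and> s' 9 < n \<and> s' 10 \<le> M \<and> s' 11 < n
    \<and> s' 11 * s' 9 ^ s' 10 mod n = s 9 ^ s 10 mod n)"
  have "n \<le> n * n" using n(2) by simp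
  then have "n \<le> M" "2 \<le> M" using n by linarith+
  have prod: "x * y \<le> M" if "x < n" "y < n" for x y
    using mult_mono[of x n y n] that n(3) by simp
  have body: "runs M 4 modpow_step (\<lambda>s'. I s' \<and> floorlog 2 (s' 10) < floorlog 2 (t 10)) t"
    if "I t" "t 10 \<noteq> 0" for t
  proof -
    note t = that[unfolded I_def]
    have t5: "t 5 = n" using agree_exceptD[of "{9,10,11}" s t 5] t n by simp
    have fl: "floorlog 2 (t 10 div 2) < floorlog 2 (t 10)"
      using t by (intro floorlog_halve) auto
    have p: "t 11 * t 9 \<le> M" "t 9 * t 9 \<le> M" using prod t by auto
    have sq: "(t 9 * t 9 mod n) ^ (t 10 div 2) mod n = t 9 ^ (t 10 div 2 * 2) mod n"
      by (simp add: power_mod mult.commute[of _ "2::nat"] power_mult power2_eq_square)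
    have even: "t 11 * (t 9 * t 9 mod n) ^ (t 10 div 2) mod n = s 9 ^ s 10 mod n"
      if "t 10 mod 2 = 0"
    proof -
      have "t 10 div 2 * 2 = t 10" using that by presburger
      then show ?thesis using t sq by (metis mod_mult_right_eq)
    qed
    have odd: "t 11 * t 9 mod n * (t 9 * t 9 mod n) ^ (t 10 div 2) mod n = s 9 ^ s 10 mod n"
      if "t 10 mod 2 \<noteq> 0"
    proof -
      have "Suc (t 10 div 2 * 2) = t 10" using that by presburger
      then have "t 9 * t 9 ^ (t 10 div 2 * 2) = t 9 ^ t 10" by (metis power_Suc)
      then have "t 11 * t 9 * t 9 ^ (t 10 div 2 * 2) mod n = s 9 ^ s 10 mod n"
        using t by (simp add: mult.assoc)
      then show ?thesis using sq by (metis mod_mult_right_eq mod_mult_left_eq)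
    qed
    show ?thesis
      using t t5 fl p even odd \<open>n \<le> M\<close> \<open>2 \<le> M\<close> n(2)
      unfolding modpow_step_def
      by (intro runs_straight) (simp_all add: cheap_def I_def bound_simps)
  qed
  have init: "I (s(11 := 1))" using assms \<open>2 \<le> M\<close> unfolding I_def by simp
  have "runs M ((4 + 1) * floorlog 2 (s 10) + 1) (While (Reg 10) modpow_step)
     (\<lambda>s'. I s' \<and> aval (Reg 10) s' = 0) (s(11 := 1))"
    by (rule runs_While[where f = "\<lambda>s. floorlog 2 (s 10)"])
      (use body init in \<open>auto simp: I_def cheap_def\<close>)
  then have loop: "runs M (5 * floorlog 2 (s 10) + 1) (While (Reg 10) modpow_step)
     (\<lambda>s'. s' 11 = s 9 ^ s 10 mod n \<and> agree_except {9,10,11} s s') (s(11 := 1))"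
    by (rule runs_mono) (auto simp: I_def)
  show ?thesis unfolding modpow_def
    by (rule runs_Seq_Assign) (use loop \<open>2 \<le> M\<close> in \<open>auto simp: cheap_def\<close>)
qed

definition euclid_step :: com where
  "euclid_step = Seq (Assign 14 (Bin binop.Mod (Reg 12) (Reg 13)))
     (Seq (Assign 12 (Reg 13)) (Assign 13 (Reg 14)))"

text \<open>
As long as \<open>v \<le> u\<close>, replacing \<open>(u, v)\<close> by \<open>(v, u mod v)\<close> at least halves the product, because
\<open>u \<ge> v + u mod v \<ge> 2 * (u mod v)\<close>. So the digits of the product are a loop variant.
\<close>

lemma runs_euclid:
  assumes "s 13 \<le> s 12" "s 12 \<le> M"
  shows "runs M (4 * floorlog 2 (s 12 * s 13) + 1) (While (Reg 13) euclid_step)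
    (\<lambda>s'. s' 12 = gcd (s 12) (s 13) \<and> agree_except {12,13,14} s s') s"
proof -
  define I where "I = (\<lambda>s'. agree_except {12,13,14} s s' \<and> s' 13 \<le> s' 12 \<and> s' 12 \<le> M
    \<and> gcd (s' 12) (s' 13) = gcd (s 12) (s 13))"
  have body: "runs M 3 euclid_step
      (\<lambda>s'. I s' \<and> floorlog 2 (s' 12 * s' 13) < floorlog 2 (t 12 * t 13)) t"
    if "I t" "aval (Reg 13) t \<noteq> 0" for t
  proof -
    note t = that[unfolded I_def]
    have "t 12 mod t 13 < t 13" using t by simp
    moreover have "t 12 mod t 13 + t 13 \<le> t 12"
      using t by (metis add.commute add_le_mono1 div_greater_zero_iff mod_div_mult_eq
          mult_le_mono1 nat_mult_1 One_nat_def Suc_leI aval.simps(2) bot_nat_0.not_eq_extremum)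
    ultimately have "2 * (t 13 * (t 12 mod t 13)) \<le> t 12 * t 13"
      using mult_le_mono1[of "2 * (t 12 mod t 13)" "t 12" "t 13"] by (simp add: mult_ac)
    moreover have "t 12 * t 13 > 0" using t by simp
    ultimately have "floorlog 2 (t 13 * (t 12 mod t 13)) < floorlog 2 (t 12 * t 13)"
      by (rule floorlog_halve)
    moreover have "gcd (t 13) (t 12 mod t 13) = gcd (s 12) (s 13)"
      using t by (metis gcd.commute gcd_red_nat)
    ultimately show ?thesis
      using t \<open>t 12 mod t 13 < t 13\<close> unfolding euclid_step_def
      by (intro runs_straight) (simp_all add: cheap_def I_def bound_simps)
  qed
  have "runs M ((3 + 1) * floorlog 2 (s 12 * s 13) + 1) (While (Reg 13) euclid_step)
      (\<lambda>s'. I s' \<and> aval (Reg 13) s' = 0) s"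
    by (rule runs_While[where f = "\<lambda>s. floorlog 2 (s 12 * s 13)"])
      (use body assms in \<open>auto simp: I_def cheap_def\<close>)
  then show ?thesis by (rule runs_mono) (auto simp: I_def)
qed

text \<open>
Subtraction in the programs is truncated, hence 1 is subtracted from a power by adding \<open>2 * n - 1\<close>.
The second multiple of \<open>n\<close> makes the sum at least \<open>n\<close>, as required by the loop of the
Euclidean algorithm.
\<close>

lemma gcd_shifted_residue:
  assumes "n > (0::nat)"
  shows "int (gcd (w ^ k mod n + (n + n - 1)) n) = gcd (int w ^ k - 1) (int n)"
proof -
  have "int (w ^ k mod n + (n + n - 1)) = int (w ^ k mod n) - 1 + 2 * int n" using assms by simp
  moreover have "[int (w ^ k mod n) - 1 + 2 * int n = int w ^ k - 1 + 0] (mod int n)"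
    by (intro cong_add cong_diff) (auto simp: cong_def zmod_int)
  ultimately have "[int (w ^ k mod n + (n + n - 1)) = int w ^ k - 1] (mod int n)"
    by (simp only: add_0_right)
  then show ?thesis by (metis cong_gcd_eq gcd_int_int_eq)
qed

definition power_residue :: "aexp \<Rightarrow> com" where
  "power_residue e = Seq (Assign 9 (Reg 8)) (Seq (Assign 10 e) modpow)"

lemma runs_power_residue:
  assumes n: "s 5 = n" "n > 1" "n * n \<le> M" "n < 2 ^ L" "s 8 < n"
    and e: "\<And>x. cheap M e (s(9 := x))" "\<And>x. aval e (s(9 := x)) = k" "k \<le> n"
  shows "runs M (5 * L + 4) (power_residue e)
    (\<lambda>s'. s' 11 = s 8 ^ k mod n \<and> agree_except {9,10,11} s s') s"
proof -
  let ?t = "s(9 := s 8, 10 := k)"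
  have "n \<le> n * n" using n(2) by simp
  then have "n \<le> M" using n(3) by linarith
  have "runs M (5 * floorlog 2 (?t 10) + 2) modpow
      (\<lambda>s'. s' 11 = ?t 9 ^ ?t 10 mod n \<and> agree_except {9,10,11} ?t s') ?t"
    using assms \<open>n \<le> M\<close> by (intro runs_modpow) auto
  moreover have "floorlog 2 k \<le> L" using e(3) n(4) by (intro floorlog_leI) auto
  ultimately have "runs M (5 * L + 2) modpow
      (\<lambda>s'. s' 11 = s 8 ^ k mod n \<and> agree_except {9,10,11} s s') ?t"
    by (elim runs_mono) (auto simp: agree_except_def)
  then show ?thesis
    using e n \<open>n \<le> M\<close> unfolding power_residue_def
    by (intro runs_Seq_Assign) (auto simp: cheap_def)
qed

definition shifted_gcd :: com where
  "shifted_gcd = Seq (Assign 12 (Bin Add (Reg 11) (Bin Sub (Bin Add (Reg 5) (Reg 5)) (Num 1))))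
     (Seq (Assign 13 (Reg 5)) (While (Reg 13) euclid_step))"

lemma runs_shifted_gcd:
  assumes n: "s 5 = n" "n > 1" "3 * n \<le> M" "n < 2 ^ L" "s 11 < n"
  shows "runs M (8 * L + 11) shifted_gcd
    (\<lambda>s'. s' 12 = gcd (s 11 + (n + n - 1)) n \<and> agree_except {12,13,14} s s') s"
proof -
  let ?t = "s(12 := s 11 + (n + n - 1), 13 := n)"
  have "runs M (4 * floorlog 2 (?t 12 * ?t 13) + 1) (While (Reg 13) euclid_step)
      (\<lambda>s'. s' 12 = gcd (?t 12) (?t 13) \<and> agree_except {12,13,14} ?t s') ?t"
    using n by (intro runs_euclid) auto
  moreover have "floorlog 2 (?t 12 * ?t 13) \<le> 2 * L + 2"
  proof (rule floorlog_leI)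
    have "?t 12 * ?t 13 \<le> 3 * 2 ^ L * 2 ^ L" unfolding fun_upd_apply
      using n(4,5) by (intro mult_mono) auto
    also have "\<dots> < 2 ^ (2 * L + 2)" by (simp add: power_add mult_2)
    finally show "?t 12 * ?t 13 < 2 ^ (2 * L + 2)" .
  qed auto
  ultimately have "runs M (8 * L + 9) (While (Reg 13) euclid_step)
      (\<lambda>s'. s' 12 = gcd (s 11 + (n + n - 1)) n \<and> agree_except {12,13,14} s s') ?t"
    by (elim runs_mono) (auto simp: agree_except_def)
  then show ?thesis
    using n unfolding shifted_gcd_def
    by (intro runs_Seq_Assign) (auto simp: cheap_def add.commute)
qed

text \<open>
The difference from 1 is the sum of the two truncated differences; the gcd in register 12 is at least
1, so one of them suffices there. The stored value is 1 if both deviations vanish, and 0 otherwise.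
\<close>

definition store_certified :: com where
  "store_certified = Assign 16 (Bin Sub (Num 1)
          (Bin Add (Bin Add (Bin Sub (Reg 15) (Num 1)) (Bin Sub (Num 1) (Reg 15)))
                   (Bin Sub (Reg 12) (Num 1))))"

definition certify :: com where
  "certify =
    Seq (power_residue (Reg 6)) (Seq (Assign 15 (Reg 11))
   (Seq (power_residue (Bin Div (Reg 6) (Reg 7))) (Seq shifted_gcd
        store_certified)))"

lemma runs_certify:
  assumes n: "s 5 = n" "n > 1" "3 * n * n \<le> M" "n < 2 ^ L"
    and s: "s 6 \<le> n" "s 7 \<le> n" "s 8 < n"
  shows "runs M (18 * L + 21) certify
    (\<lambda>s'. s' 16 = of_bool (certifies n (s 6) (s 7) (s 8)) \<and> agree_except {9..16} s s') s"
proof -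
  have "3 * n * 1 \<le> 3 * n * n" "n * n * 1 \<le> n * n * 3" using n(2) by (intro mult_left_mono; simp)+
  then have M: "3 * n \<le> M" "n * n \<le> M" "n \<le> M" "2 \<le> M" using n by linarith+
  define x where "x = s 8 ^ s 6 mod n"
  let ?y = "s 8 ^ (s 6 div s 7) mod n"
  define g where "g = gcd (?y + (n + n - 1)) n"
  have "x < n" "?y < n" using n(2) unfolding x_def by auto
  have g: "g \<ge> 1" "g \<le> n" using n(2) unfolding g_def by (auto simp: Suc_le_eq gcd_le2_nat)
  have "gcd (int (s 8) ^ (s 6 div s 7) - 1) (int n) = int g"
    unfolding g_def using gcd_shifted_residue n(2) by simp
  then have cert: "certifies n (s 6) (s 7) (s 8) \<longleftrightarrow> x = 1 \<and> g = 1"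
    using n(2) unfolding certifies_def cong_def x_def by simp
  show ?thesis unfolding certify_def
  proof (rule runs_call)
    show "runs M (5 * L + 4) (power_residue (Reg 6))
        (\<lambda>s'. s' 11 = x \<and> agree_except {9,10,11} s s') s"
      using n s M by (subst x_def, intro runs_power_residue) (auto simp: cheap_def)
  next
    fix s1 assume s1: "s1 11 = x \<and> agree_except {9,10,11} s s1"
    then have r1: "s1 5 = n" "s1 6 = s 6" "s1 7 = s 7" "s1 8 = s 8"
      using n(1) agree_exceptD[of "{9,10,11}" s s1] by auto
    let ?s1 = "s1(15 := s1 11)"
    have "runs M (16 + 13 * L) (Seq (power_residue (Bin Div (Reg 6) (Reg 7))) (Seq shifted_gcd
        store_certified))
      (\<lambda>s'. s' 16 = of_bool (certifies n (s 6) (s 7) (s 8)) \<and> agree_except {9..16} s s') ?s1"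
    proof (rule runs_call)
      show "runs M (5 * L + 4) (power_residue (Bin Div (Reg 6) (Reg 7)))
          (\<lambda>s'. s' 11 = ?s1 8 ^ (s 6 div s 7) mod n \<and> agree_except {9,10,11} ?s1 s') ?s1"
        using n s M r1 by (intro runs_power_residue) (auto simp: cheap_def bound_simps)
    next
      fix s2 assume s2: "s2 11 = ?s1 8 ^ (s 6 div s 7) mod n \<and> agree_except {9,10,11} ?s1 s2"
      then have r2: "s2 5 = n" "s2 15 = x" "s2 11 = ?y"
        using s1 r1 agree_exceptD[of "{9,10,11}" ?s1 s2] by auto
      show "runs M (16 + 13 * L - (5 * L + 4)) (Seq shifted_gcd
          store_certified)
        (\<lambda>s'. s' 16 = of_bool (certifies n (s 6) (s 7) (s 8)) \<and> agree_except {9..16} s s') s2"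
      proof (rule runs_call)
        show "runs M (8 * L + 11) shifted_gcd
          (\<lambda>s'. s' 12 = gcd (s2 11 + (n + n - 1)) n \<and> agree_except {12,13,14} s2 s') s2"
          using n M r2 \<open>?y < n\<close> by (intro runs_shifted_gcd) auto
      next
        fix s3 assume s3: "s3 12 = gcd (s2 11 + (n + n - 1)) n \<and> agree_except {12,13,14} s2 s3"
        then have r3: "s3 15 = x" "s3 12 = g"
          using r2 agree_exceptD[of "{12,13,14}" s2 s3] by (auto simp: g_def)
        have "agree_except {9..16} s s3"
          using s1 s2 s3 by (auto simp: agree_except_def)
        then show "runs M (16 + 13 * L - (5 * L + 4) - (8 * L + 11))
           store_certified
          (\<lambda>s'. s' 16 = of_bool (certifies n (s 6) (s 7) (s 8))
             \<and> agree_except {9..16} s s') s3"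
          unfolding store_certified_def
          using r3 g \<open>x < n\<close> M cert by (intro runs_Assign) (auto simp: cheap_def)
      qed simp
    qed simp
    then show "runs M (18 * L + 21 - (5 * L + 4)) (Seq (Assign 15 (Reg 11))
       (Seq (power_residue (Bin Div (Reg 6) (Reg 7))) (Seq shifted_gcd
        store_certified)))
      (\<lambda>s'. s' 16 = of_bool (certifies n (s 6) (s 7) (s 8)) \<and> agree_except {9..16} s s') s1"
      using s1 M \<open>x < n\<close> by (intro runs_Seq_Assign) (simp_all add: cheap_def)
  qed simp
qed

section \<open>Searching and stripping\<close>

definition search_step :: com where
  "search_step = Seq certify (Seq (Assign 17 (Bin Add (Reg 17) (Reg 16)))
     (Assign 8 (Bin Sub (Reg 8) (Num 1))))"

definition search :: com where
  "search = Seq (Assign 17 (Num 0)) (Seq (Assign 8 (Reg 19)) (While (Reg 8) search_step))"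

lemma runs_search:
  assumes n: "s 5 = n" "n > 1" "3 * n * n \<le> M" "n < 2 ^ L"
    and s: "s 6 \<le> n" "s 7 \<le> n" "s 19 < n"
  shows "runs M ((24 + 18 * L) * s 19 + 3) search
    (\<lambda>s'. (s' 17 \<noteq> 0 \<longleftrightarrow> (\<exists>w\<in>{1..s 19}. certifies n (s 6) (s 7) w))
      \<and> s' 17 \<le> s 19 \<and> agree_except {8..17} s s') s"
proof -
  define I where "I = (\<lambda>t. agree_except {8..17} s t \<and> t 8 \<le> s 19 \<and> t 17 \<le> s 19 - t 8
    \<and> (t 17 \<noteq> 0 \<longleftrightarrow> (\<exists>w\<in>{t 8<..s 19}. certifies n (s 6) (s 7) w)))"
  have "n * 1 \<le> n * (3 * n)" using n(2) by (intro mult_left_mono) auto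
  then have M: "n \<le> M" using n(3) by (simp only: mult_ac)
  have body: "runs M (18 * L + 23) search_step (\<lambda>s'. I s' \<and> s' 8 < t 8) t"
    if "I t" "aval (Reg 8) t \<noteq> 0" for t
    unfolding search_step_def
  proof (rule runs_call)
    note t = that[unfolded I_def]
    have r: "t 5 = n" "t 6 = s 6" "t 7 = s 7"
      using t n(1) agree_exceptD[of "{8..17}" s t] by auto
    show "runs M (18 * L + 21) certify
      (\<lambda>s'. s' 16 = of_bool (certifies n (s 6) (s 7) (t 8)) \<and> agree_except {9..16} t s') t"
      using runs_certify[of t n M L] n s t r by simp
    fix s1 assume s1: "s1 16 = of_bool (certifies n (s 6) (s 7) (t 8)) \<and> agree_except {9..16} t s1"
    then have r1: "s1 8 = t 8" "s1 17 = t 17" using agree_exceptD[of "{9..16}" t s1] by auto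
    have ag: "agree_except {8..17} s s1" using s1 t by (auto simp: agree_except_def)
    have set: "{t 8 - 1<..s 19} = insert (t 8) {t 8<..s 19}" using t by auto
    have count: "t 17 + of_bool (certifies n (s 6) (s 7) (t 8)) \<le> s 19 - (t 8 - Suc 0)"
      "t 17 + of_bool (certifies n (s 6) (s 7) (t 8)) \<le> M" "t 17 \<le> M" "t 8 \<le> M"
      "t 8 - Suc 0 \<le> M" "t 8 - Suc 0 \<le> s 19"
      using t s M by (auto simp: of_bool_def)
    have flag: "0 < t 17 \<longleftrightarrow> (\<exists>w\<in>{t 8<..s 19}. certifies n (s 6) (s 7) w)"
      using t by simp
    have ex: "(\<exists>w\<in>{t 8 - Suc 0<..s 19}. certifies n (s 6) (s 7) w) \<longleftrightarrow>
        certifies n (s 6) (s 7) (t 8) \<or> (\<exists>w\<in>{t 8<..s 19}. certifies n (s 6) (s 7) w)"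
      using set by simp
    show "runs M (18 * L + 23 - (18 * L + 21)) (Seq (Assign 17 (Bin Add (Reg 17) (Reg 16)))
       (Assign 8 (Bin Sub (Reg 8) (Num 1)))) (\<lambda>s'. I s' \<and> s' 8 < t 8) s1"
      using s1 r1 ag t(1,2) count s M
      by (intro runs_straight) (simp_all add: cheap_def I_def ex flag disj_commute)
  qed simp
  have "runs M ((18 * L + 23 + 1) * s 19 + 1) (While (Reg 8) search_step)
      (\<lambda>s'. I s' \<and> aval (Reg 8) s' = 0) (s(17 := 0, 8 := s 19))"
    by (rule runs_While[where f = "\<lambda>s. s 8"])
      (use body s M in \<open>auto simp: I_def cheap_def\<close>)
  then have "runs M ((24 + 18 * L) * s 19 + 1) (While (Reg 8) search_step)
    (\<lambda>s'. (s' 17 \<noteq> 0 \<longleftrightarrow> (\<exists>w\<in>{1..s 19}. certifies n (s 6) (s 7) w))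
      \<and> s' 17 \<le> s 19 \<and> agree_except {8..17} s s') (s(17 := 0, 8 := s 19))"
    by (rule runs_mono) (auto simp: I_def Suc_le_eq)
  then show ?thesis
    unfolding search_def using s M by (intro runs_Seq_Assign) (auto simp: cheap_def)
qed

definition strip_step :: com where
  "strip_step = Seq search (If (Reg 17) (Assign 18 (Num 0))
     (If (Bin binop.Mod (Reg 6) (Reg 7)) (Assign 18 (Num 0)) (Assign 6 (Bin Div (Reg 6) (Reg 7)))))"

definition strip :: com where
  "strip = Seq (Assign 18 (Num 1)) (While (Reg 18) strip_step)"

text \<open>
Modulo a prime \<open>n\<close>, the gcd in a certificate is either 1 or \<open>n\<close>.
\<close>

lemma not_certifies_prime:
  assumes "prime n" "[w ^ e = 1] (mod n)" "\<not> certifies n e q w"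
  shows "[w ^ (e div q) = 1] (mod n)"
proof -
  have "\<not> coprime (int n) (int w ^ (e div q) - 1)"
    using assms unfolding certifies_def by (simp add: coprime_commute coprime_iff_gcd_eq_1 gcd.commute)
  then have "int n dvd int w ^ (e div q) - 1"
    using assms(1) by (metis prime_imp_coprime prime_nat_int_transfer)
  then have "[int w ^ (e div q) = 1] (mod int n)" by (simp add: cong_iff_dvd_diff)
  then show ?thesis by (metis cong_int_iff of_nat_1 of_nat_power)
qed

text \<open>
The loop divides the exponent by \<open>q\<close> as long as this is possible and no \<open>w \<le> W\<close> certifies it. It stops
because the power of \<open>q\<close> is exhausted or because a certificate has been found; either way the
remaining power of \<open>q\<close> divides \<open>r - 1\<close> for all prime divisors \<open>r\<close> of \<open>n\<close>. If \<open>n\<close> is prime, a division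
takes place only if all small residues are annihilated by the smaller exponent as well. The flag in
register 18 contributes to the variant for the iteration that merely clears it.
\<close>

lemma runs_strip:
  assumes n: "s 5 = n" "n > 1" "3 * n * n \<le> M" "n < 2 ^ L"
    and q: "prime q" "s 7 = q" "q \<le> n" "\<not> q dvd k" "s 6 = k * q ^ i" "0 < s 6" "s 6 \<le> n"
    and W: "s 19 = W" "W < n"
    and w: "\<And>w. prime n \<Longrightarrow> 1 \<le> w \<Longrightarrow> w \<le> W \<Longrightarrow> [w ^ s 6 = 1] (mod n)"
  shows "runs M (((24 + 18 * L) * W + 7) * (L + 1) + 2) strip
    (\<lambda>s'. (\<exists>j. s' 6 = k * q ^ j \<and> (j = 0 \<or> (\<exists>w. certifies n (s' 6) q w)))
      \<and> 0 < s' 6 \<and> s' 6 \<le> n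
      \<and> (prime n \<longrightarrow> (\<forall>w. 1 \<le> w \<longrightarrow> w \<le> W \<longrightarrow> [w ^ s' 6 = 1] (mod n)))
      \<and> agree_except (insert 6 {8..18}) s s') s"
proof -
  define K where "K = (24 + 18 * L) * W"
  define I where "I = (\<lambda>t. agree_except (insert 6 {8..18}) s t \<and> t 18 \<le> 1
    \<and> (\<exists>j. t 6 = k * q ^ j \<and> (t 18 = 0 \<longrightarrow> j = 0 \<or> (\<exists>w. certifies n (t 6) q w)))
    \<and> 0 < t 6 \<and> t 6 \<le> n
    \<and> (prime n \<longrightarrow> (\<forall>w. 1 \<le> w \<longrightarrow> w \<le> W \<longrightarrow> [w ^ t 6 = 1] (mod n))))"
  have "n * 1 \<le> n * (3 * n)" using n(2) by (intro mult_left_mono) auto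
  then have M: "n \<le> M" using n(3) by (simp only: mult_ac)
  have body: "runs M (K + 6) strip_step
      (\<lambda>s'. I s' \<and> floorlog 2 (s' 6) + s' 18 < floorlog 2 (t 6) + t 18) t"
    if "I t" "aval (Reg 18) t \<noteq> 0" for t
    unfolding strip_step_def
  proof (rule runs_call)
    note t = that[unfolded I_def]
    have agt: "agree_except (insert 6 {8..18}) s t" and t6: "0 < t 6" "t 6 \<le> n"
      using t by simp_all
    have r: "t 5 = n" "t 7 = q" "t 19 = W"
      using n(1) q(2) W(1) agree_exceptD[OF agt] by simp_all
    have t18: "t 18 = 1" using t by simp
    obtain j where j: "t 6 = k * q ^ j" using t by blast
    show "runs M (K + 3) search
      (\<lambda>s'. (s' 17 \<noteq> 0 \<longleftrightarrow> (\<exists>w\<in>{1..W}. certifies n (t 6) q w))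
        \<and> s' 17 \<le> W \<and> agree_except {8..17} t s') t"
      using runs_search[of t n M L] n(2-4) W q(3) t6 r unfolding K_def by simp
    fix s1 assume s1: "(s1 17 \<noteq> 0 \<longleftrightarrow> (\<exists>w\<in>{1..W}. certifies n (t 6) q w))
        \<and> s1 17 \<le> W \<and> agree_except {8..17} t s1"
    then have r1: "s1 6 = t 6" "s1 7 = q" "s1 18 = 1"
      using r(2) t18 agree_exceptD[of "{8..17}" t s1] by simp_all
    have ag: "agree_except (insert 6 {8..18}) s s1" using s1 agt by (auto simp: agree_except_def)
    have fl: "floorlog 2 (t 6 div q) < floorlog 2 (t 6)"
    proof (rule floorlog_halve)
      have "t 6 div q \<le> t 6 div 2" using prime_ge_2_nat[OF q(1)] by (intro div_le_mono2) auto
      then show "2 * (t 6 div q) \<le> t 6" by linarith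
    qed (rule t6)
    have found: "I (s1(18 := 0))" if "s1 17 \<noteq> 0"
    proof -
      have "\<exists>w. certifies n (t 6) q w" using that s1 by blast
      then have "\<exists>j. t 6 = k * q ^ j \<and> (j = 0 \<or> (\<exists>w. certifies n (t 6) q w))" using j by blast
      then show ?thesis using r1(1) ag t unfolding I_def by simp
    qed
    have indivisible: "I (s1(18 := 0))" if "t 6 mod q \<noteq> 0"
    proof -
      have "j = 0" using that j by (cases j) auto
      then have "\<exists>j. t 6 = k * q ^ j \<and> (j = 0 \<or> (\<exists>w. certifies n (t 6) q w))" using j by blast
      then show ?thesis using r1(1) ag t unfolding I_def by simp
    qed
    have divide: "I (s1(6 := t 6 div q))" if d: "t 6 mod q = 0" "s1 17 = 0"
    proof -
      have "q dvd k * q ^ j" using d(1) j by (simp add: dvd_eq_mod_eq_0)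
      then obtain j' where "j = Suc j'" using q(4) by (cases j) auto
      then have 1: "t 6 div q = k * q ^ j'" using j q(1) by (simp add: prime_gt_0_nat)
      have 2: "0 < t 6 div q" unfolding 1 using t6(1) j prime_gt_0_nat[OF q(1)] by simp
      have 3: "[w ^ (t 6 div q) = 1] (mod n)" if "prime n" "1 \<le> w" "w \<le> W" for w
        using that s1 d(2) t by (intro not_certifies_prime) simp_all
      from 1 have "\<exists>j. t 6 div q = k * q ^ j" by blast
      then show ?thesis using 2 3 r1 ag t(1) t18 unfolding I_def by (simp add: bound_simps)
    qed
    show "runs M (K + 6 - (K + 3)) (If (Reg 17) (Assign 18 (Num 0))
       (If (Bin binop.Mod (Reg 6) (Reg 7)) (Assign 18 (Num 0)) (Assign 6 (Bin Div (Reg 6) (Reg 7)))))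
      (\<lambda>s'. I s' \<and> floorlog 2 (s' 6) + s' 18 < floorlog 2 (t 6) + t 18) s1"
      using r1 s1 t18 fl found indivisible divide t W q n M
      by (intro runs_straight) (simp_all add: cheap_def bound_simps)
  qed simp
  have fl: "floorlog 2 (s 6) \<le> L" using q(7) n(4) by (intro floorlog_leI) auto
  have "runs M ((K + 6 + 1) * (L + 1) + 1) (While (Reg 18) strip_step)
      (\<lambda>s'. I s' \<and> aval (Reg 18) s' = 0) (s(18 := 1))"
  proof (rule runs_While[where f = "\<lambda>s. floorlog 2 (s 6) + s 18"])
    have "\<exists>j. s 6 = k * q ^ j" using q(5) by blast
    then show "I (s(18 := 1))" using q(6,7) w unfolding I_def by simp
    show "cheap M (Reg 18) t" if "I t" for t using that M n(2) unfolding I_def by (simp add: cheap_def)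
  qed (use body fl in auto)
  then have "runs M ((K + 7) * (L + 1) + 1) (While (Reg 18) strip_step)
    (\<lambda>s'. (\<exists>j. s' 6 = k * q ^ j \<and> (j = 0 \<or> (\<exists>w. certifies n (s' 6) q w)))
      \<and> 0 < s' 6 \<and> s' 6 \<le> n
      \<and> (prime n \<longrightarrow> (\<forall>w. 1 \<le> w \<longrightarrow> w \<le> W \<longrightarrow> [w ^ s' 6 = 1] (mod n)))
      \<and> agree_except (insert 6 {8..18}) s s') (s(18 := 1))"
  proof (rule runs_mono)
    fix s' assume "I s' \<and> aval (Reg 18) s' = 0"
    then have I': "I s'" and "s' 18 = 0" by simp_all
    then have "\<exists>j. s' 6 = k * q ^ j \<and> (j = 0 \<or> (\<exists>w. certifies n (s' 6) q w))"
      unfolding I_def by blast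
    then show "(\<exists>j. s' 6 = k * q ^ j \<and> (j = 0 \<or> (\<exists>w. certifies n (s' 6) q w)))
      \<and> 0 < s' 6 \<and> s' 6 \<le> n
      \<and> (prime n \<longrightarrow> (\<forall>w. 1 \<le> w \<longrightarrow> w \<le> W \<longrightarrow> [w ^ s' 6 = 1] (mod n)))
      \<and> agree_except (insert 6 {8..18}) s s'"
      using I' unfolding I_def by (intro conjI) simp_all
  qed simp
  then show ?thesis
    unfolding strip_def K_def using n M by (intro runs_Seq_Assign) (auto simp: cheap_def)
qed

section \<open>Integer square roots\<close>

definition sqrt_step :: com where
  "sqrt_step = Seq (Assign 26 (Bin Div (Bin Add (Reg 24) (Reg 25)) (Num 2)))
     (If (Bin Sub (Bin Mul (Reg 26) (Reg 26)) (Reg 23)) (Assign 25 (Reg 26)) (Assign 24 (Reg 26)))"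

definition floor_root :: com where
  "floor_root = Seq (Assign 24 (Num 0)) (Seq (Assign 25 (Bin Add (Reg 23) (Num 1)))
     (While (Bin Sub (Bin Sub (Reg 25) (Reg 24)) (Num 1)) sqrt_step))"

text \<open>
Bisection with invariant \<open>r24\<^sup>2 \<le> d < r25\<^sup>2\<close>. The gap minus 1 is at least halved in each step.
\<close>

lemma runs_floor_root:
  assumes d: "s 23 = d" "(d + 2)\<^sup>2 \<le> M" "d < 2 ^ L"
  shows "runs M (4 * L + 3) floor_root
    (\<lambda>s'. (s' 24)\<^sup>2 \<le> d \<and> d < (Suc (s' 24))\<^sup>2 \<and> agree_except {24,25,26} s s') s"
proof -
  define I where "I = (\<lambda>t. agree_except {24,25,26} s t \<and> (t 24)\<^sup>2 \<le> d \<and> d < (t 25)\<^sup>2 \<and> t 25 \<le> d + 1)"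
  have "(d + 2) * 2 \<le> (d + 2)\<^sup>2" unfolding power2_eq_square by (intro mult_left_mono) auto
  then have M: "(d + 2) * 2 \<le> M" using d(2) by linarith
  have sq: "x * x \<le> M" if "x \<le> d + 1" for x
  proof -
    have "x\<^sup>2 \<le> (d + 2)\<^sup>2" using that by (intro power_mono) auto
    then show ?thesis using d(2) by (simp add: power2_eq_square)
  qed
  have lt: "t 24 < t 25" if "I t" for t
  proof -
    have "(t 24)\<^sup>2 < (t 25)\<^sup>2" using that unfolding I_def by linarith
    then show ?thesis using power_less_imp_less_base by blast
  qed
  have body: "runs M 3 sqrt_step
      (\<lambda>s'. I s' \<and> floorlog 2 (s' 25 - s' 24 - 1) < floorlog 2 (t 25 - t 24 - 1)) t"
    if "I t" "aval (Bin Sub (Bin Sub (Reg 25) (Reg 24)) (Num 1)) t \<noteq> 0" for t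
  proof -
    note t = that[unfolded I_def]
    have t23: "t 23 = d" using t d agree_exceptD[of "{24,25,26}" s t 23] by simp
    define mid where "mid = (t 24 + t 25) div 2"
    have m: "t 24 < mid" "mid < t 25" "mid \<le> d + 1" using t unfolding mid_def by auto
    have f1: "floorlog 2 (mid - t 24 - 1) < floorlog 2 (t 25 - t 24 - 1)"
      and f2: "floorlog 2 (t 25 - mid - 1) < floorlog 2 (t 25 - t 24 - 1)"
      using t unfolding mid_def by (intro floorlog_halve; auto)+
    show ?thesis
      unfolding sqrt_step_def
      using t t23 m f1 f2 sq[OF m(3)] M
      by (intro runs_straight) (auto simp: cheap_def I_def power2_eq_square simp flip: mid_def)
  qed
  have "runs M ((3 + 1) * L + 1) (While (Bin Sub (Bin Sub (Reg 25) (Reg 24)) (Num 1)) sqrt_step)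
      (\<lambda>s'. I s' \<and> aval (Bin Sub (Bin Sub (Reg 25) (Reg 24)) (Num 1)) s' = 0) (s(24 := 0, 25 := d + 1))"
  proof (rule runs_While[where f = "\<lambda>s. floorlog 2 (s 25 - s 24 - 1)"])
    show "cheap M (Bin Sub (Bin Sub (Reg 25) (Reg 24)) (Num 1)) t" if "I t" for t
      using that lt[OF that] M by (auto simp: cheap_def I_def)
    show "I (s(24 := 0, 25 := d + 1))" unfolding I_def by (simp add: power2_eq_square)
    show "floorlog 2 ((s(24 := 0, 25 := d + 1)) 25 - (s(24 := 0, 25 := d + 1)) 24 - 1) \<le> L"
      using d(3) by (simp add: floorlog_leI)
  qed (rule body)
  then have "runs M (4 * L + 1) (While (Bin Sub (Bin Sub (Reg 25) (Reg 24)) (Num 1)) sqrt_step)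
      (\<lambda>s'. (s' 24)\<^sup>2 \<le> d \<and> d < (Suc (s' 24))\<^sup>2 \<and> agree_except {24,25,26} s s')
      (s(24 := 0, 25 := d + 1))"
  proof (rule runs_mono)
    fix t assume t: "I t \<and> aval (Bin Sub (Bin Sub (Reg 25) (Reg 24)) (Num 1)) t = 0"
    then have "t 25 = Suc (t 24)" using lt[of t] by simp
    then show "(t 24)\<^sup>2 \<le> d \<and> d < (Suc (t 24))\<^sup>2 \<and> agree_except {24,25,26} s t"
      using t unfolding I_def by simp
  qed simp
  then show ?thesis
    unfolding floor_root_def using d M by (intro runs_Seq_Assign) (auto simp: cheap_def)
qed

section \<open>Checking a pair of witnesses\<close>

definition scale_loop :: "nat \<Rightarrow> nat \<Rightarrow> com" where
  "scale_loop r b = While (Reg r)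
     (Seq (Assign 4 (Bin Mul (Reg 4) (Num b))) (Assign r (Bin Sub (Reg r) (Num 1))))"

lemma runs_scale_loop:
  assumes "r \<noteq> 4" "b \<ge> 1" "b \<le> M" "s r \<le> M" "s 4 * b ^ s r \<le> M"
  shows "runs M (3 * s r + 1) (scale_loop r b)
    (\<lambda>s'. s' 4 = s 4 * b ^ s r \<and> agree_except {r, 4} s s') s"
proof -
  define I where "I = (\<lambda>t. agree_except {r, 4} s t \<and> t r \<le> s r \<and> t 4 * b ^ t r = s 4 * b ^ s r)"
  have body: "runs M 2 (Seq (Assign 4 (Bin Mul (Reg 4) (Num b))) (Assign r (Bin Sub (Reg r) (Num 1))))
      (\<lambda>s'. I s' \<and> s' r < t r) t" if "I t" "aval (Reg r) t \<noteq> 0" for t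
  proof -
    note t = that[unfolded I_def]
    obtain x where x: "t r = Suc x" using t by (cases "t r") auto
    have 1: "t 4 * b ^ Suc x = s 4 * b ^ s r" using t x by simp
    have "t 4 * b * 1 \<le> t 4 * b * b ^ x" using assms(2) by (intro mult_left_mono) auto
    then have 2: "t 4 * b \<le> M" using 1 assms(5) by (simp only: mult_1_right power_Suc mult.assoc)
    have "t 4 * 1 \<le> t 4 * b" using assms(2) by (intro mult_left_mono) auto
    then have 3: "t 4 \<le> M" using 2 by linarith
    show ?thesis using t 1 2 3 x assms
      by (intro runs_straight) (auto simp: cheap_def I_def mult.assoc)
  qed
  have "runs M ((2 + 1) * s r + 1) (scale_loop r b) (\<lambda>s'. I s' \<and> aval (Reg r) s' = 0) s"
    unfolding scale_loop_def by (rule runs_While[where f = "\<lambda>s. s r"])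
      (use body assms in \<open>auto simp: I_def cheap_def\<close>)
  then show ?thesis by (rule runs_mono) (auto simp: I_def)
qed

definition setup_modulus :: com where
  "setup_modulus = Seq (Assign 4 (Num 1)) (Seq (scale_loop 0 2) (Seq (scale_loop 1 3)
     (Seq (Assign 4 (Bin Sub (Reg 4) (Num 1)))
          (Assign 5 (Bin Add (Bin Mul (Bin Mul (Num 3) (Reg 4)) (Bin Add (Reg 4) (Num 1))) (Num 1))))))"

lemma m_of_less_p_of: "m_of a b < p_of a b"
  unfolding p_of_def by (simp add: trans_le_add2)

lemma power2_le_Suc_m_of: "2 ^ (a + b) \<le> Suc (m_of a b)"
proof -
  have "(2::nat) ^ b \<le> 3 ^ b" by (intro power_mono) auto
  then have "(2::nat) ^ (a + b) \<le> 2 ^ a * 3 ^ b" unfolding power_add by (intro mult_left_mono) auto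
  then show ?thesis unfolding m_of_def by linarith
qed

lemma exponent_sum_le: "a + b \<le> m_of a b"
  using power2_le_Suc_m_of[of a b] less_exp[of "a + b"] by linarith

lemma runs_setup_modulus:
  assumes "s 0 = a" "s 1 = b" "a \<ge> 1" "b \<ge> 1" "p_of a b \<le> M"
  shows "runs M (3 * (a + b) + 5) setup_modulus
    (\<lambda>s'. s' 4 = m_of a b \<and> s' 5 = p_of a b \<and> agree_except {0,1,4,5} s s') s"
proof -
  let ?m = "m_of a b" and ?p = "p_of a b"
  have m: "Suc ?m = 2 ^ a * 3 ^ b" "?m \<ge> 5" using m_of_bounds assms by simp_all
  have le: "Suc ?m \<le> M" "a \<le> M" "b \<le> M" "3 \<le> M"
    using m_of_less_p_of[of a b] exponent_sum_le[of a b] m(2) assms(5) by linarith+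
  have p: "3 * ?m * Suc ?m + 1 = ?p" unfolding p_of_def by simp
  then have pl: "3 * ?m * Suc ?m \<le> M" using assms(5) by linarith
  have "3 * ?m * 1 \<le> 3 * ?m * Suc ?m" by (intro mult_left_mono) auto
  then have 3: "3 * ?m \<le> M" using pl by linarith
  have "(2::nat) ^ a * 1 \<le> 2 ^ a * 3 ^ b" by (intro mult_left_mono) auto
  then have 2: "2 ^ a \<le> M" using le(1) m(1) by linarith
  have "runs M (3 * a + 3 * b + 4)
    (Seq (scale_loop 0 2) (Seq (scale_loop 1 3) (Seq (Assign 4 (Bin Sub (Reg 4) (Num 1)))
      (Assign 5 (Bin Add (Bin Mul (Bin Mul (Num 3) (Reg 4)) (Bin Add (Reg 4) (Num 1))) (Num 1))))))
    (\<lambda>s'. s' 4 = m_of a b \<and> s' 5 = p_of a b \<and> agree_except {0,1,4,5} s s') (s(4 := 1))"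
  proof (rule runs_call)
    show "runs M (3 * a + 1) (scale_loop 0 2)
      (\<lambda>s'. s' 4 = 2 ^ a \<and> agree_except {0, 4} (s(4 := 1)) s') (s(4 := 1))"
      using runs_scale_loop[of 0 2 M "s(4 := 1)"] assms le 2 by simp
    fix s1 assume s1: "s1 4 = 2 ^ a \<and> agree_except {0, 4} (s(4 := 1)) s1"
    then have r1: "s1 1 = b" using agree_exceptD[of "{0,4}" "s(4 := 1)" s1 1] assms by simp
    show "runs M (3 * a + 3 * b + 4 - (3 * a + 1)) (Seq (scale_loop 1 3)
       (Seq (Assign 4 (Bin Sub (Reg 4) (Num 1)))
       (Assign 5 (Bin Add (Bin Mul (Bin Mul (Num 3) (Reg 4)) (Bin Add (Reg 4) (Num 1))) (Num 1)))))
       (\<lambda>s'. s' 4 = m_of a b \<and> s' 5 = p_of a b \<and> agree_except {0,1,4,5} s s') s1"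
    proof (rule runs_call)
      show "runs M (3 * b + 1) (scale_loop 1 3)
        (\<lambda>s'. s' 4 = Suc ?m \<and> agree_except {1, 4} s1 s') s1"
        using runs_scale_loop[of 1 3 M s1] s1 r1 le m by simp
      fix s2 assume s2: "s2 4 = Suc ?m \<and> agree_except {1, 4} s1 s2"
      have ag: "agree_except {0,1,4,5} s s2" using s1 s2 by (auto simp: agree_except_def)
      show "runs M (3 * a + 3 * b + 4 - (3 * a + 1) - (3 * b + 1))
         (Seq (Assign 4 (Bin Sub (Reg 4) (Num 1)))
         (Assign 5 (Bin Add (Bin Mul (Bin Mul (Num 3) (Reg 4)) (Bin Add (Reg 4) (Num 1))) (Num 1))))
         (\<lambda>s'. s' 4 = m_of a b \<and> s' 5 = p_of a b \<and> agree_except {0,1,4,5} s s') s2"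
        using s2 ag le 3 pl p assms(5)
        by (intro runs_straight) (simp_all add: cheap_def)
    qed simp
  qed simp
  then show ?thesis
    unfolding setup_modulus_def using le by (intro runs_Seq_Assign) (auto simp: cheap_def algebra_simps)
qed

definition check_witnesses :: com where
  "check_witnesses = Seq setup_modulus (Seq (Assign 6 (Bin Sub (Reg 5) (Num 1)))
    (Seq (Assign 7 (Num 2)) (Seq (Assign 8 (Reg 2)) (Seq certify
    (Seq (Assign 17 (Reg 16))
    (Seq (Assign 7 (Num 3)) (Seq (Assign 8 (Reg 3)) (Seq certify
         (Assign 0 (Bin Mul (Reg 17) (Reg 16)))))))))))"

text \<open>
The budget consists of \<open>3 * (a + b) + 5\<close> for the modulus, two tests of \<open>18 * L + 21\<close>, and seven
assignments.
\<close>

lemma runs_check_witnesses: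
  assumes "s 0 = a" "s 1 = b" "s 2 = w2" "s 3 = w3" "a \<ge> 1" "b \<ge> 1" "w2 < p_of a b" "w3 < p_of a b"
    "3 * p_of a b * p_of a b \<le> M" "p_of a b < 2 ^ L"
  shows "runs M (3 * (a + b) + 36 * L + 54) check_witnesses
    (\<lambda>s'. s' 0 \<noteq> 0 \<longleftrightarrow> witness (p_of a b) 2 (int w2) \<and> witness (p_of a b) 3 (int w3)) s"
  unfolding check_witnesses_def
proof (rule runs_call)
  define n where "n = p_of a b"
  have n: "n \<ge> 91" using p_of_ge assms unfolding n_def by simp
  then have "3 * n * 1 \<le> 3 * n * n" by (intro mult_left_mono) auto
  then have M: "3 * n \<le> M" using assms(9) unfolding n_def by linarith
  show "runs M (3 * (a + b) + 5) setup_modulus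
    (\<lambda>s'. s' 4 = m_of a b \<and> s' 5 = p_of a b \<and> agree_except {0,1,4,5} s s') s"
    using assms M by (intro runs_setup_modulus) (auto simp: n_def)
  fix s1 assume s1: "s1 4 = m_of a b \<and> s1 5 = p_of a b \<and> agree_except {0,1,4,5} s s1"
  then have r1: "s1 2 = w2" "s1 3 = w3" "s1 5 = n"
    using agree_exceptD[of "{0,1,4,5}" s s1] assms by (simp_all add: n_def)
  let ?s1 = "s1(6 := n - 1, 7 := 2, 8 := w2)"
  have "runs M (36 * L + 46) (Seq certify
      (Seq (Assign 17 (Reg 16)) (Seq (Assign 7 (Num 3)) (Seq (Assign 8 (Reg 3)) (Seq certify
         (Assign 0 (Bin Mul (Reg 17) (Reg 16))))))))
    (\<lambda>s'. s' 0 \<noteq> 0 \<longleftrightarrow> certifies n (n - 1) 2 w2 \<and> certifies n (n - 1) 3 w3) ?s1"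
  proof (rule runs_call)
    show "runs M (18 * L + 21) certify
      (\<lambda>s'. s' 16 = of_bool (certifies n (n - 1) 2 w2) \<and> agree_except {9..16} ?s1 s') ?s1"
      using runs_certify[of ?s1 n M L] assms n r1 by (simp add: n_def)
    fix s2 assume s2: "s2 16 = of_bool (certifies n (n - 1) 2 w2) \<and> agree_except {9..16} ?s1 s2"
    then have r2: "s2 3 = w3" "s2 5 = n" "s2 6 = n - 1"
      using agree_exceptD[of "{9..16}" ?s1 s2] r1 by simp_all
    let ?c = "of_bool (certifies n (n - 1) 2 w2) :: nat"
    let ?s2 = "s2(17 := ?c, 7 := 3, 8 := w3)"
    have "runs M (18 * L + 22) (Seq certify (Assign 0 (Bin Mul (Reg 17) (Reg 16))))
      (\<lambda>s'. s' 0 \<noteq> 0 \<longleftrightarrow> certifies n (n - 1) 2 w2 \<and> certifies n (n - 1) 3 w3) ?s2"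
    proof (rule runs_call)
      show "runs M (18 * L + 21) certify
        (\<lambda>s'. s' 16 = of_bool (certifies n (n - 1) 3 w3) \<and> agree_except {9..16} ?s2 s') ?s2"
        using runs_certify[of ?s2 n M L] assms n r2 by (simp add: n_def)
      fix s3 assume s3: "s3 16 = of_bool (certifies n (n - 1) 3 w3) \<and> agree_except {9..16} ?s2 s3"
      then have r3: "s3 17 = ?c" using agree_exceptD[of "{9..16}" ?s2 s3] by simp
      show "runs M (18 * L + 22 - (18 * L + 21)) (Assign 0 (Bin Mul (Reg 17) (Reg 16)))
        (\<lambda>s'. s' 0 \<noteq> 0 \<longleftrightarrow> certifies n (n - 1) 2 w2 \<and> certifies n (n - 1) 3 w3) s3"
        using s3 r3 n M by (intro runs_Assign) (auto simp: cheap_def of_bool_def)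
    qed simp
    then have "runs M (36 * L + 46 - (18 * L + 21) - 1 - 1 - 1)
        (Seq certify (Assign 0 (Bin Mul (Reg 17) (Reg 16))))
      (\<lambda>s'. s' 0 \<noteq> 0 \<longleftrightarrow> certifies n (n - 1) 2 w2 \<and> certifies n (n - 1) 3 w3) ?s2"
      by (rule runs_mono) auto
    then show "runs M (36 * L + 46 - (18 * L + 21))
      (Seq (Assign 17 (Reg 16)) (Seq (Assign 7 (Num 3)) (Seq (Assign 8 (Reg 3)) (Seq certify
         (Assign 0 (Bin Mul (Reg 17) (Reg 16)))))))
      (\<lambda>s'. s' 0 \<noteq> 0 \<longleftrightarrow> certifies n (n - 1) 2 w2 \<and> certifies n (n - 1) 3 w3) s2"
      using s2 r2 n M assms
      by (intro runs_Seq_Assign) (simp_all add: cheap_def of_bool_def n_def)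
  qed simp
  then have "runs M (3 * (a + b) + 36 * L + 54 - (3 * (a + b) + 5) - 1 - 1 - 1) (Seq certify
      (Seq (Assign 17 (Reg 16)) (Seq (Assign 7 (Num 3)) (Seq (Assign 8 (Reg 3)) (Seq certify
         (Assign 0 (Bin Mul (Reg 17) (Reg 16))))))))
    (\<lambda>s'. s' 0 \<noteq> 0 \<longleftrightarrow> witness (p_of a b) 2 (int w2) \<and> witness (p_of a b) 3 (int w3)) ?s1"
    by (rule runs_mono) (simp_all add: witness_iff_certifies n_def)
  then show "runs M (3 * (a + b) + 36 * L + 54 - (3 * (a + b) + 5))
    (Seq (Assign 6 (Bin Sub (Reg 5) (Num 1))) (Seq (Assign 7 (Num 2)) (Seq (Assign 8 (Reg 2))
      (Seq certify (Seq (Assign 17 (Reg 16)) (Seq (Assign 7 (Num 3)) (Seq (Assign 8 (Reg 3))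
        (Seq certify (Assign 0 (Bin Mul (Reg 17) (Reg 16)))))))))))
    (\<lambda>s'. s' 0 \<noteq> 0 \<longleftrightarrow> witness (p_of a b) 2 (int w2) \<and> witness (p_of a b) 3 (int w3)) s1"
    using r1 n M assms by (intro runs_Seq_Assign) (simp_all add: cheap_def n_def)
qed simp

section \<open>The decision procedure\<close>

fun power_exp :: "aexp \<Rightarrow> nat \<Rightarrow> aexp" where
  "power_exp e 0 = Num 1"
| "power_exp e (Suc k) = Bin Mul e (power_exp e k)"

lemma aval_power_exp [simp]: "aval (power_exp e k) s = aval e s ^ k"
  by (induction k) auto

lemma nodes_power_exp: "nodes (power_exp e k) = (nodes e + 1) * k + 1"
  by (induction k) auto

lemma fits_power_exp:
  assumes "fits M e s" "aval e s \<ge> 1" "aval e s ^ k \<le> M"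
  shows "fits M (power_exp e k) s"
  using assms(3)
proof (induction k)
  case (Suc k)
  have "1 * aval e s ^ k \<le> aval e s * aval e s ^ k" using assms(2) by (intro mult_right_mono) auto
  then have "aval e s ^ k \<le> M" using Suc.prems by (simp only: power_Suc mult_1)
  then show ?case using Suc assms(1) by simp
qed simp

text \<open>
With \<open>l = 4 * (a + b)\<close> binary digits available for \<open>p\<close>, the bound \<open>(2 * l) ^ 264\<close> is the one required
by \<open>small_residues_exponent_bound\<close>. It is capped at \<open>p - 1\<close>, since multiples of \<open>p\<close> are not annihilated.
\<close>

definition setup_bound :: com where
  "setup_bound = Seq (Assign 20 (Bin Mul (Num 8) (Bin Add (Reg 0) (Reg 1))))
     (Seq (Assign 19 (power_exp (Reg 20) 264)) (Seq setup_modulus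
     (If (Bin Sub (Reg 5) (Reg 19)) Skip (Assign 19 (Bin Sub (Reg 5) (Num 1))))))"

lemma runs_setup_bound:
  assumes "s 0 = a" "s 1 = b" "a \<ge> 1" "b \<ge> 1" "p_of a b \<le> M" "(8 * (a + b)) ^ 264 \<le> M"
  shows "runs M (3 * (a + b) + 9) setup_bound
    (\<lambda>s'. s' 4 = m_of a b \<and> s' 5 = p_of a b
       \<and> s' 19 = min ((8 * (a + b)) ^ 264) (p_of a b - 1)) s"
proof -
  define D where "D = 8 * (a + b)"
  define W where "W = D ^ 264"
  have D: "D \<ge> 1" "a + b \<le> D" "D \<ge> 8" unfolding D_def using assms by auto
  have W: "W \<le> M" unfolding W_def D_def using assms by simp
  have "D ^ 1 \<le> D ^ 264" using D by (intro power_increasing) auto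
  then have "D \<le> M" using W unfolding W_def by simp
  let ?s = "s(20 := D, 19 := W)"
  have cheap: "cheap M (power_exp (Reg 20) 264) (s(20 := D))"
    unfolding cheap_def
    using fits_power_exp[of M "Reg 20" "s(20 := D)" 264] W D \<open>D \<le> M\<close>
    by (simp add: nodes_power_exp W_def del: power_exp.simps)
  have "runs M (3 * (a + b) + 7) (Seq setup_modulus
     (If (Bin Sub (Reg 5) (Reg 19)) Skip (Assign 19 (Bin Sub (Reg 5) (Num 1)))))
    (\<lambda>s'. s' 4 = m_of a b \<and> s' 5 = p_of a b \<and> s' 19 = min W (p_of a b - 1)) ?s"
  proof (rule runs_call)
    show "runs M (3 * (a + b) + 5) setup_modulus
      (\<lambda>s'. s' 4 = m_of a b \<and> s' 5 = p_of a b \<and> agree_except {0,1,4,5} ?s s') ?s"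
      using assms by (intro runs_setup_modulus) auto
    fix s1 assume s1: "s1 4 = m_of a b \<and> s1 5 = p_of a b \<and> agree_except {0,1,4,5} ?s s1"
    then have r1: "s1 19 = W" using agree_exceptD[of "{0,1,4,5}" ?s s1 19] by simp
    show "runs M (3 * (a + b) + 7 - (3 * (a + b) + 5))
      (If (Bin Sub (Reg 5) (Reg 19)) Skip (Assign 19 (Bin Sub (Reg 5) (Num 1))))
      (\<lambda>s'. s' 4 = m_of a b \<and> s' 5 = p_of a b \<and> s' 19 = min W (p_of a b - 1)) s1"
      using s1 r1 W assms p_of_ge[OF assms(3,4)]
      by (intro runs_straight) (auto simp: cheap_def)
  qed simp
  then have run: "runs M (3 * (a + b) + 9 - 1 - 1) (Seq setup_modulus
     (If (Bin Sub (Reg 5) (Reg 19)) Skip (Assign 19 (Bin Sub (Reg 5) (Num 1)))))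
    (\<lambda>s'. s' 4 = m_of a b \<and> s' 5 = p_of a b \<and> s' 19 = min W (p_of a b - 1)) ?s"
    by (rule runs_mono) auto
  have run': "runs M (3 * (a + b) + 9 - 1) (Seq (Assign 19 (power_exp (Reg 20) 264)) (Seq setup_modulus
     (If (Bin Sub (Reg 5) (Reg 19)) Skip (Assign 19 (Bin Sub (Reg 5) (Num 1))))))
    (\<lambda>s'. s' 4 = m_of a b \<and> s' 5 = p_of a b \<and> s' 19 = min W (p_of a b - 1)) (s(20 := D))"
    by (rule runs_Seq_Assign[OF _ cheap]) (use run in \<open>simp_all add: W_def\<close>)
  have "runs M (3 * (a + b) + 9) setup_bound
    (\<lambda>s'. s' 4 = m_of a b \<and> s' 5 = p_of a b \<and> s' 19 = min W (p_of a b - 1)) s"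
    unfolding setup_bound_def
    by (rule runs_Seq_Assign)
      (use run' assms(1,2) D \<open>D \<le> M\<close> D_def[symmetric] in \<open>simp_all add: cheap_def distrib_left del: power_exp.simps\<close>)
  then show ?thesis unfolding W_def D_def .
qed

definition strip_both :: com where
  "strip_both = Seq (Assign 6 (Bin Sub (Reg 5) (Num 1))) (Seq (Assign 7 (Num 2)) (Seq strip
     (Seq (Assign 7 (Num 3)) strip)))"

text \<open>
The two primes are stripped one after the other: stripping 3 leaves the power of 2 in the exponent
unchanged, so the conclusion drawn from the first phase remains valid for the final exponent
\<open>m * E\<close>, \<open>E = 2 ^ i * 3 ^ j\<close>.
\<close>

lemma runs_strip_both:
  assumes "a \<ge> 1" "b \<ge> 1" and n: "n = p_of a b" "3 * n * n \<le> M" "n < 2 ^ L"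
    and s: "s 4 = m_of a b" "s 5 = n" "s 19 = W" "W < n"
  shows "runs M (2 * (((24 + 18 * L) * W + 7) * (L + 1)) + 7) strip_both
    (\<lambda>s'. \<exists>E. s' 4 = m_of a b \<and> s' 5 = n \<and> s' 6 = m_of a b * E \<and> 0 < E \<and> s' 6 \<le> n
       \<and> (\<forall>r. prime r \<longrightarrow> r dvd n \<longrightarrow> E dvd r - 1)
       \<and> (prime n \<longrightarrow> (\<forall>w. 1 \<le> w \<longrightarrow> w \<le> W \<longrightarrow> [w ^ s' 6 = 1] (mod n)))) s"
proof -
  let ?m = "m_of a b"
  define K where "K = ((24 + 18 * L) * W + 7) * (L + 1)"
  define Q where "Q = (\<lambda>s' :: state. \<exists>E. s' 4 = m_of a b \<and> s' 5 = n \<and> s' 6 = m_of a b * E \<and> 0 < E \<and> s' 6 \<le> n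
       \<and> (\<forall>r. prime r \<longrightarrow> r dvd n \<longrightarrow> E dvd r - 1)
       \<and> (prime n \<longrightarrow> (\<forall>w. 1 \<le> w \<longrightarrow> w \<le> W \<longrightarrow> [w ^ s' 6 = 1] (mod n))))"
  have n91: "n \<ge> 91" using p_of_ge assms by simp
  then have "3 * n * 1 \<le> 3 * n * n" by (intro mult_left_mono) auto
  then have M: "3 * n \<le> M" using n(2) by linarith
  have m: "\<not> 2 dvd ?m * 3 ^ Suc b" "\<not> 3 dvd ?m" "?m \<ge> 5"
    using m_of_bounds[OF assms(1,2)] by (simp_all add: prime_dvd_mult_iff prime_dvd_power_iff)
  then have "0 < ?m" by simp
  have pred: "n - 1 = ?m * 3 ^ Suc b * 2 ^ a" unfolding n(1) by (rule p_of_pred)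
  let ?s = "s(6 := n - 1, 7 := 2)"
  have fermat: "[w ^ (n - 1) = 1] (mod n)" if "prime n" "1 \<le> w" "w \<le> W" for w
    using that s(4) by (intro fermat_theorem) (auto dest: dvd_imp_le)
  have "runs M (2 * K + 5) (Seq strip (Seq (Assign 7 (Num 3)) strip)) Q ?s"
  proof (rule runs_call)
    show "runs M (K + 2) strip
      (\<lambda>s'. (\<exists>i. s' 6 = ?m * 3 ^ Suc b * 2 ^ i \<and> (i = 0 \<or> (\<exists>w. certifies n (s' 6) 2 w)))
      \<and> 0 < s' 6 \<and> s' 6 \<le> n
      \<and> (prime n \<longrightarrow> (\<forall>w. 1 \<le> w \<longrightarrow> w \<le> W \<longrightarrow> [w ^ s' 6 = 1] (mod n)))
      \<and> agree_except (insert 6 {8..18}) ?s s') ?s"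
      unfolding K_def
      by (rule runs_strip[where i = a]) (use n91 n s m(1) \<open>0 < ?m\<close> pred fermat in auto)
    fix s1 assume s1: "(\<exists>i. s1 6 = ?m * 3 ^ Suc b * 2 ^ i \<and> (i = 0 \<or> (\<exists>w. certifies n (s1 6) 2 w)))
      \<and> 0 < s1 6 \<and> s1 6 \<le> n
      \<and> (prime n \<longrightarrow> (\<forall>w. 1 \<le> w \<longrightarrow> w \<le> W \<longrightarrow> [w ^ s1 6 = 1] (mod n)))
      \<and> agree_except (insert 6 {8..18}) ?s s1"
    then have ag1: "agree_except (insert 6 {8..18}) ?s s1" by blast
    have r1: "s1 4 = ?m" "s1 5 = n" "s1 19 = W"
      using s agree_exceptD[OF ag1] by simp_all
    from s1 obtain i where i: "s1 6 = ?m * 3 ^ Suc b * 2 ^ i"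
      "i = 0 \<or> (\<exists>w. certifies n (s1 6) 2 w)" by blast
    have two: "2 ^ i dvd r - 1" if "prime r" "r dvd n" for r
    proof (cases "i = 0")
      case False
      then obtain w where "certifies n (?m * 3 ^ Suc b * 2 ^ i) 2 w" using i by auto
      from certified_prime_power_dvd[OF this _ that] show ?thesis by simp
    qed simp
    let ?s1 = "s1(7 := 3)"
    have ndvd: "\<not> 3 dvd ?m * 2 ^ i"
    proof
      assume "3 dvd ?m * 2 ^ i"
      then have "3 dvd (2::nat) ^ i" using m(2) by (simp add: prime_dvd_mult_iff)
      then have "3 dvd (2::nat)" by (rule prime_dvd_power[rotated]) simp
      then show False by simp
    qed
    have s16: "s1 6 = ?m * 2 ^ i * 3 ^ Suc b" unfolding i(1) by simp
    have res: "[w ^ s1 6 = 1] (mod n)" if "prime n" "1 \<le> w" "w \<le> W" for w using s1 that by blast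
    have "runs M (K + 2) strip
      (\<lambda>s'. (\<exists>j. s' 6 = ?m * 2 ^ i * 3 ^ j \<and> (j = 0 \<or> (\<exists>w. certifies n (s' 6) 3 w)))
      \<and> 0 < s' 6 \<and> s' 6 \<le> n
      \<and> (prime n \<longrightarrow> (\<forall>w. 1 \<le> w \<longrightarrow> w \<le> W \<longrightarrow> [w ^ s' 6 = 1] (mod n)))
      \<and> agree_except (insert 6 {8..18}) ?s1 s') ?s1"
      unfolding K_def
      by (rule runs_strip[where i = "Suc b"]) (use n91 n s r1 ndvd s16 s1 res in simp_all)
    then have "runs M (K + 2) strip Q ?s1"
    proof (rule runs_mono)
      fix s2 assume s2: "(\<exists>j. s2 6 = ?m * 2 ^ i * 3 ^ j \<and> (j = 0 \<or> (\<exists>w. certifies n (s2 6) 3 w)))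
        \<and> 0 < s2 6 \<and> s2 6 \<le> n
        \<and> (prime n \<longrightarrow> (\<forall>w. 1 \<le> w \<longrightarrow> w \<le> W \<longrightarrow> [w ^ s2 6 = 1] (mod n)))
        \<and> agree_except (insert 6 {8..18}) ?s1 s2"
      then have ag2: "agree_except (insert 6 {8..18}) ?s1 s2" by blast
      have r2: "s2 4 = ?m" "s2 5 = n" using r1 agree_exceptD[OF ag2] by simp_all
      from s2 obtain j where j: "s2 6 = ?m * 2 ^ i * 3 ^ j"
        "j = 0 \<or> (\<exists>w. certifies n (s2 6) 3 w)" by blast
      have three: "3 ^ j dvd r - 1" if "prime r" "r dvd n" for r
      proof (cases "j = 0")
        case False
        then obtain w where "certifies n (?m * 2 ^ i * 3 ^ j) 3 w" using j by auto
        from certified_prime_power_dvd[OF this _ that] show ?thesis by simp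
      qed simp
      have "2 ^ i * 3 ^ j dvd r - 1" if "prime r" "r dvd n" for r
        using two[OF that] three[OF that] by (intro divides_mult) auto
      then show "Q s2" unfolding Q_def
        using r2 s2 j(1) by (intro exI[of _ "2 ^ i * 3 ^ j"]) (simp add: mult.assoc)
    qed simp
    then have "runs M (2 * K + 5 - (K + 2) - 1) strip Q ?s1" by (rule runs_mono) auto
    then show "runs M (2 * K + 5 - (K + 2)) (Seq (Assign 7 (Num 3)) strip) Q s1"
      using M n91 by (intro runs_Seq_Assign) (simp_all add: cheap_def)
  qed simp
  then have "runs M (2 * K + 7 - 1 - 1) (Seq strip (Seq (Assign 7 (Num 3)) strip)) Q ?s"
    by (rule runs_mono) simp_all
  then have "runs M (2 * K + 7) strip_both Q s"
    unfolding strip_both_def using M n91 s by (intro runs_Seq_Assign) (simp_all add: cheap_def)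
  then show ?thesis unfolding K_def Q_def .
qed

text \<open>
The answer is 1 if the cube of register 20, which holds \<open>E\<close>, exceeds \<open>n\<close> and the candidate in
register 27 is not a proper divisor of \<open>n\<close>.
\<close>

definition divisor_test :: com where
  "divisor_test = If (Bin Sub (Bin Mul (Reg 20) (Bin Mul (Reg 20) (Reg 20))) (Reg 5))
      (If (Bin Sub (Reg 27) (Num 1))
        (If (Bin Sub (Reg 5) (Reg 27))
          (If (Bin binop.Mod (Reg 5) (Reg 27)) (Assign 0 (Num 1)) (Assign 0 (Num 0)))
          (Assign 0 (Num 1)))
        (Assign 0 (Num 1)))
      (Assign 0 (Num 0))"

definition verdict :: com where
  "verdict =
     Seq (Assign 20 (Bin Div (Reg 6) (Reg 4)))
    (Seq (Assign 21 (Bin binop.Mod (Bin Div (Bin Sub (Reg 5) (Num 1)) (Reg 20)) (Reg 20)))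
    (Seq (Assign 22 (Bin Div (Bin Div (Bin Sub (Reg 5) (Num 1)) (Reg 20)) (Reg 20)))
    (Seq (Assign 23 (Bin Sub (Bin Mul (Reg 21) (Reg 21)) (Bin Mul (Num 4) (Reg 22))))
    (Seq floor_root
    (Seq (Assign 27 (Bin Add (Num 1) (Bin Mul (Bin Div (Bin Add (Reg 21) (Reg 24)) (Num 2)) (Reg 20))))
    divisor_test)))))"

text \<open>
For prime \<open>n\<close>, the cube of \<open>E\<close> exceeds \<open>n\<close> and the candidate, whatever its value, cannot be a proper
divisor. For composite \<open>n\<close> with \<open>n < E ^ 3\<close>, the candidate is a proper divisor by
\<open>composite_divisor_formula\<close>; there the truncation in the discriminant is harmless, as \<open>c0\<^sup>2 \<ge> 4 * c1\<close>.
\<close>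

lemma runs_verdict:
  assumes "a \<ge> 1" "b \<ge> 1" and n: "n = p_of a b" "16 * n ^ 4 \<le> M" "n < 2 ^ L"
    and s: "s 4 = m_of a b" "s 5 = n" "s 6 = m_of a b * E" "0 < E" "s 6 \<le> n"
    and div: "\<And>r. prime r \<Longrightarrow> r dvd n \<Longrightarrow> E dvd r - 1"
    and big: "prime n \<Longrightarrow> n ^ 5 \<le> (m_of a b * E) ^ 6"
  shows "runs M (8 * L + 13) verdict (\<lambda>s'. s' 0 \<noteq> 0 \<longleftrightarrow> prime n) s"
proof -
  let ?m = "m_of a b"
  define Q where "Q = (\<lambda>s'::state. s' 0 \<noteq> 0 \<longleftrightarrow> prime n)"
  have n91: "n \<ge> 91" using p_of_ge assms by simp
  have m: "?m \<ge> 5" using m_of_bounds assms by simp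
  have "1 * E \<le> ?m * E" using m by (intro mult_right_mono) auto
  then have E: "E \<le> n" using s by linarith
  define c where "c = (n - 1) div E"
  define c0 where "c0 = c mod E"
  define c1 where "c1 = c div E"
  define d where "d = c0 * c0 - 4 * c1"
  have cn: "c \<le> n" "c0 \<le> n" "c1 \<le> n" unfolding c0_def c1_def c_def by (auto intro!: bound_simps)
  have cc: "c0 * c0 \<le> n * n" using cn by (intro mult_mono) auto
  then have dn: "d \<le> n * n" unfolding d_def by (rule bound_simps(3))
  have pow: "n * n * (16 * (n * n)) \<le> M" using n(2) by (simp add: power4_eq_xxxx mult_ac)
  have "1 * (16 * (n * n)) \<le> n * n * (16 * (n * n))" using n91 by (intro mult_right_mono) auto
  then have M2: "16 * (n * n) \<le> M" using pow by linarith
  have "16 * n * 1 \<le> 16 * n * n" using n91 by (intro mult_left_mono) auto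
  moreover have "16 * n * n \<le> M" using M2 by (simp only: mult.assoc)
  ultimately have M1: "16 * n \<le> M" by linarith
  have EE: "E * E \<le> n * n" using E by (intro mult_mono) auto
  have "E * (E * E) \<le> n * (n * n)" using E EE by (intro mult_mono) auto
  also have "\<dots> \<le> n * n * (16 * (n * n))" using n91 by (simp add: mult_ac)
  finally have EEE: "E * (E * E) \<le> M" using pow by linarith
  let ?s = "s(20 := E, 21 := c0, 22 := c1, 23 := d)"
  have dM: "(d + 2)\<^sup>2 \<le> M"
  proof -
    have "1 * 1 \<le> n * n" using n91 by (intro mult_mono) auto
    then have "d + 2 \<le> 4 * (n * n)" using dn by linarith
    then have "(d + 2)\<^sup>2 \<le> (4 * (n * n))\<^sup>2" by (intro power_mono) auto
    also have "\<dots> = n * n * (16 * (n * n))" by (simp add: power2_eq_square)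
    finally show ?thesis using pow by linarith
  qed
  have dL: "d < 2 ^ (2 * L)"
  proof -
    have "n * n < 2 ^ L * 2 ^ L" using n(3) by (intro mult_strict_mono) auto
    then show ?thesis using dn by (simp add: mult_2 power_add)
  qed
  have tail: "runs M 6
    (Seq (Assign 27 (Bin Add (Num 1) (Bin Mul (Bin Div (Bin Add (Reg 21) (Reg 24)) (Num 2)) (Reg 20))))
    divisor_test) Q t"
    if t: "(t 24)\<^sup>2 \<le> d" "d < (Suc (t 24))\<^sup>2" "agree_except {24,25,26} ?s t" for t
  proof -
    have r: "t 5 = n" "t 20 = E" "t 21 = c0" using agree_exceptD[OF t(3)] s by simp_all
    define h where "h = (c0 + t 24) div 2"
    define q where "q = 1 + h * E"
    have "(t 24)\<^sup>2 \<le> n\<^sup>2" using t(1) dn by (simp add: power2_eq_square)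
    then have t24: "t 24 \<le> n" using power2_le_imp_le by blast
    have h: "h \<le> n" unfolding h_def using t24 cn by linarith
    then have hE: "h * E \<le> n * n" using E by (intro mult_mono) auto
    have d': "d = (((n - 1) div E mod E)\<^sup>2 - 4 * ((n - 1) div E div E))"
      unfolding d_def c0_def c1_def c_def by (simp add: power2_eq_square)
    have comp: "1 < q \<and> q < n \<and> q dvd n" if "n < E ^ 3" "\<not> prime n"
      using composite_divisor_formula[OF div that(1) _ that(2), of "t 24"] t(1,2) n91
      unfolding d' q_def h_def c0_def c_def by simp
    have correct: "prime n \<longleftrightarrow> n < E ^ 3 \<and> \<not> (1 < q \<and> q < n \<and> q dvd n)"
    proof
      assume "prime n"
      have "n < E ^ 3"
        using cube_gt_of_exponent_bound[of n ?m E] big[OF \<open>prime n\<close>] m n(1) unfolding p_of_def by simp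
      moreover have "\<not> (1 < q \<and> q < n \<and> q dvd n)" using \<open>prime n\<close> prime_nat_iff[of n] by auto
      ultimately show "n < E ^ 3 \<and> \<not> (1 < q \<and> q < n \<and> q dvd n)" by blast
    qed (use comp in blast)
    have correct': "prime n \<longleftrightarrow> n < E * (E * E) \<and> \<not> (Suc 0 < q \<and> q < n \<and> n mod q = 0)"
      using correct by (simp add: power3_eq_cube mult.assoc dvd_eq_mod_eq_0)
    have qM: "q \<le> M" unfolding q_def using hE M1 M2 n91 by linarith
    have bounds: "c0 + t 24 \<le> M" "h \<le> M" "h * E \<le> M" "E \<le> M" "c0 \<le> M" "t 24 \<le> M"
      "n \<le> M" "1 \<le> M" "2 \<le> M" "E * E \<le> M"
      using hE h E EE cn t24 M1 M2 n91 by linarith+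
    show ?thesis
    proof (rule runs_Seq_Assign)
      show "runs M (6 - 1)
        divisor_test Q (t(27 := aval (Bin Add (Num 1) (Bin Mul (Bin Div (Bin Add (Reg 21) (Reg 24)) (Num 2)) (Reg 20))) t))"
      proof -
        have "aval (Bin Add (Num 1) (Bin Mul (Bin Div (Bin Add (Reg 21) (Reg 24)) (Num 2)) (Reg 20))) t = q"
          using r by (simp add: q_def h_def)
        then show ?thesis
          using r bounds qM EEE correct'
          unfolding divisor_test_def
          by (intro runs_straight; simp add: cheap_def Q_def bound_simps)
      qed
    qed (use r bounds qM in \<open>simp_all add: cheap_def q_def h_def\<close>)
  qed
  have "runs M (9 + 8 * L) (Seq floor_root
    (Seq (Assign 27 (Bin Add (Num 1) (Bin Mul (Bin Div (Bin Add (Reg 21) (Reg 24)) (Num 2)) (Reg 20))))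
    divisor_test)) Q ?s"
  proof (rule runs_call)
    show "runs M (4 * (2 * L) + 3) floor_root
      (\<lambda>s'. (s' 24)\<^sup>2 \<le> d \<and> d < (Suc (s' 24))\<^sup>2 \<and> agree_except {24,25,26} ?s s') ?s"
      using dM dL by (intro runs_floor_root) auto
  qed (use tail in auto)
  moreover have "s 6 div ?m = E" "?m \<le> M" using s m m_of_less_p_of[of a b] n(1) M1 by simp_all
  ultimately have "runs M (8 * L + 13) verdict Q s"
    unfolding verdict_def
    using s n91 cc cn E M1 M2 m c_def[symmetric] c0_def[symmetric] c1_def[symmetric] d_def[symmetric]
    by (intro runs_Seq_Assign) (simp_all add: cheap_def bound_simps)
  then show ?thesis unfolding Q_def .
qed

definition decide_prime :: com where
  "decide_prime = Seq setup_bound (Seq strip_both verdict)"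

lemma runs_decide_prime:
  assumes "s 0 = a" "s 1 = b" "a \<ge> 1" "b \<ge> 1" and n: "n = p_of a b" "n < 2 ^ (4 * (a + b))"
    and M: "16 * n ^ 4 \<le> M" "W \<le> M" "W = (8 * (a + b)) ^ 264" and L: "L = 4 * (a + b)"
  shows "runs M (3 * (a + b) + 2 * (((24 + 18 * L) * W + 7) * (L + 1)) + 8 * L + 29) decide_prime
    (\<lambda>s'. s' 0 \<noteq> 0 \<longleftrightarrow> prime n) s"
proof -
  have n91: "n \<ge> 91" using p_of_ge assms by simp
  have "1 * (16 * (n * n)) \<le> n * n * (16 * (n * n))" using n91 by (intro mult_right_mono) auto
  moreover have "n * n * (16 * (n * n)) \<le> M" using M(1) by (simp add: power4_eq_xxxx mult_ac)
  ultimately have M2: "16 * (n * n) \<le> M" by linarith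
  have "16 * n * 1 \<le> 16 * n * n" using n91 by (intro mult_left_mono) auto
  moreover have "16 * n * n \<le> M" using M2 by (simp only: mult.assoc)
  ultimately have M1: "16 * n \<le> M" by linarith
  define K where "K = 2 * (((24 + 18 * L) * W + 7) * (L + 1)) + 7"
  let ?W = "min W (n - 1)"
  have K: "2 * (((24 + 18 * L) * ?W + 7) * (L + 1)) + 7 \<le> K"
    unfolding K_def by (intro add_mono mult_mono) auto
  have "runs M (3 * (a + b) + K + 8 * L + 22) decide_prime (\<lambda>s'. s' 0 \<noteq> 0 \<longleftrightarrow> prime n) s"
    unfolding decide_prime_def
  proof (rule runs_call)
    show "runs M (3 * (a + b) + 9) setup_bound
      (\<lambda>s'. s' 4 = m_of a b \<and> s' 5 = n \<and> s' 19 = ?W) s"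
      unfolding n(1) M(3) using assms M1 by (intro runs_setup_bound) auto
    fix s1 :: state assume s1: "s1 4 = m_of a b \<and> s1 5 = n \<and> s1 19 = ?W"
    show "runs M (3 * (a + b) + K + 8 * L + 22 - (3 * (a + b) + 9)) (Seq strip_both verdict)
      (\<lambda>s'. s' 0 \<noteq> 0 \<longleftrightarrow> prime n) s1"
    proof (rule runs_call)
      have "runs M (2 * (((24 + 18 * L) * ?W + 7) * (L + 1)) + 7) strip_both
        (\<lambda>s'. \<exists>E. s' 4 = m_of a b \<and> s' 5 = n \<and> s' 6 = m_of a b * E \<and> 0 < E \<and> s' 6 \<le> n
          \<and> (\<forall>r. prime r \<longrightarrow> r dvd n \<longrightarrow> E dvd r - 1)
          \<and> (prime n \<longrightarrow> (\<forall>w. 1 \<le> w \<longrightarrow> w \<le> ?W \<longrightarrow> [w ^ s' 6 = 1] (mod n)))) s1"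
        using assms s1 M2 n91 by (intro runs_strip_both) auto
      then show "runs M K strip_both
        (\<lambda>s'. \<exists>E. s' 4 = m_of a b \<and> s' 5 = n \<and> s' 6 = m_of a b * E \<and> 0 < E \<and> s' 6 \<le> n
          \<and> (\<forall>r. prime r \<longrightarrow> r dvd n \<longrightarrow> E dvd r - 1)
          \<and> (prime n \<longrightarrow> (\<forall>w. 1 \<le> w \<longrightarrow> w \<le> ?W \<longrightarrow> [w ^ s' 6 = 1] (mod n)))) s1"
        using K by (rule runs_mono)
      fix s2 :: state assume "\<exists>E. s2 4 = m_of a b \<and> s2 5 = n \<and> s2 6 = m_of a b * E \<and> 0 < E \<and> s2 6 \<le> n
          \<and> (\<forall>r. prime r \<longrightarrow> r dvd n \<longrightarrow> E dvd r - 1)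
          \<and> (prime n \<longrightarrow> (\<forall>w. 1 \<le> w \<longrightarrow> w \<le> ?W \<longrightarrow> [w ^ s2 6 = 1] (mod n)))"
      then obtain E where E: "s2 4 = m_of a b" "s2 5 = n" "s2 6 = m_of a b * E" "0 < E" "s2 6 \<le> n"
          "\<And>r. prime r \<Longrightarrow> r dvd n \<Longrightarrow> E dvd r - 1"
          "\<And>w. prime n \<Longrightarrow> 1 \<le> w \<Longrightarrow> w \<le> ?W \<Longrightarrow> [w ^ s2 6 = 1] (mod n)" by blast
      have "n ^ 5 \<le> (m_of a b * E) ^ 6" if "prime n"
      proof (rule small_residues_exponent_bound[OF that])
        show "0 < m_of a b * E" using E(4) m_of_bounds(1)[OF assms(3,4)] by simp
        show "n \<le> 2 ^ (4 * (a + b))" using n(2) by simp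
        show "(2 * (4 * (a + b))) ^ 264 \<le> W" unfolding M(3) by simp
        show "[w ^ (m_of a b * E) = 1] (mod n)" if "1 \<le> w" "w \<le> ?W" for w
          using E(7)[OF \<open>prime n\<close> that] E(3) by simp
      qed (use n91 in simp)
      then have "runs M (8 * L + 13) verdict (\<lambda>s'. s' 0 \<noteq> 0 \<longleftrightarrow> prime n) s2"
        using E assms by (intro runs_verdict[where E = E]) auto
      then show "runs M (3 * (a + b) + K + 8 * L + 22 - (3 * (a + b) + 9) - K) verdict
        (\<lambda>s'. s' 0 \<noteq> 0 \<longleftrightarrow> prime n) s2" by (rule runs_mono) simp_all
    qed simp
  qed simp
  then show ?thesis unfolding K_def by (simp only: add_ac) simp
qed

section \<open>Polynomial time\<close>

lemma p_of_less_power2: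
  assumes "a \<ge> 1"
  shows "p_of a b < 2 ^ (4 * (a + b))"
proof -
  define N :: nat where "N = 2 ^ a * 3 ^ b"
  obtain m where m: "N = Suc m" unfolding N_def by (cases "2 ^ a * 3 ^ b :: nat") auto
  have "m_of a b = m" using m unfolding m_of_def N_def by simp
  then have "p_of a b \<le> 3 * (N * N)" unfolding p_of_def m by simp
  also have "\<dots> = 3 * 4 ^ a * 9 ^ b"
    unfolding N_def by (simp add: mult_ac flip: power_mult_distrib)
  also have "\<dots> < 16 ^ a * 16 ^ b"
  proof (rule mult_less_le_imp_less)
    have "(4::nat) ^ 1 \<le> 4 ^ a" using assms by (intro power_increasing) auto
    then have "3 * (4::nat) ^ a < 4 ^ a * 4 ^ a" by simp
    then show "3 * (4::nat) ^ a < 16 ^ a" by (simp flip: power_mult_distrib)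
  qed (auto intro: power_mono)
  also have "\<dots> = 2 ^ (4 * (a + b))" by (simp add: power_mult power_add)
  finally show ?thesis .
qed

definition poly_bounded :: "(nat \<Rightarrow> nat) \<Rightarrow> bool" where
  "poly_bounded f \<longleftrightarrow> (\<exists>C k. \<forall>x\<ge>1. f x \<le> C * x ^ k)"

lemma poly_bounded_const: "poly_bounded (\<lambda>x. c)"
  unfolding poly_bounded_def by (intro exI[of _ c] exI[of _ 0]) simp

lemma poly_bounded_id: "poly_bounded (\<lambda>x. x)"
  unfolding poly_bounded_def by (intro exI[of _ 1]) simp

lemma poly_bounded_add:
  assumes "poly_bounded f" "poly_bounded g"
  shows "poly_bounded (\<lambda>x. f x + g x)"
proof -
  obtain C k D l where *: "\<And>x. x \<ge> 1 \<Longrightarrow> f x \<le> C * x ^ k" "\<And>x. x \<ge> 1 \<Longrightarrow> g x \<le> D * x ^ l"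
    using assms unfolding poly_bounded_def by blast
  have "f x + g x \<le> (C + D) * x ^ (k + l)" if "x \<ge> 1" for x
  proof -
    have "x ^ k \<le> x ^ (k + l)" "x ^ l \<le> x ^ (k + l)" using that by (intro power_increasing; simp)+
    then have "C * x ^ k \<le> C * x ^ (k + l)" "D * x ^ l \<le> D * x ^ (k + l)" by simp_all
    then show ?thesis using *(1)[OF that] *(2)[OF that] unfolding distrib_right by linarith
  qed
  then show ?thesis unfolding poly_bounded_def by blast
qed

lemma poly_bounded_mult:
  assumes "poly_bounded f" "poly_bounded g"
  shows "poly_bounded (\<lambda>x. f x * g x)"
proof -
  obtain C k D l where *: "\<And>x. x \<ge> 1 \<Longrightarrow> f x \<le> C * x ^ k" "\<And>x. x \<ge> 1 \<Longrightarrow> g x \<le> D * x ^ l"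
    using assms unfolding poly_bounded_def by blast
  have "f x * g x \<le> (C * D) * x ^ (k + l)" if "x \<ge> 1" for x
    using mult_mono[OF *(1)[OF that] *(2)[OF that]] by (simp add: power_add mult_ac)
  then show ?thesis unfolding poly_bounded_def by blast
qed

lemma poly_bounded_power: "poly_bounded f \<Longrightarrow> poly_bounded (\<lambda>x. f x ^ k)"
  by (induction k) (auto intro: poly_bounded_const poly_bounded_mult)

lemmas poly_bounded_intros =
  poly_bounded_const poly_bounded_id poly_bounded_add poly_bounded_mult poly_bounded_power

lemma tick_power2: "tick (2 ^ e) = 1 + 1000 * (2 + e)\<^sup>2"
proof -
  have "floorlog 2 (1 * 2 ^ e) = floorlog 2 1 + e" by (rule floorlog_power) auto
  moreover have "floorlog 2 1 = 1" by (simp add: floorlog_def)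
  ultimately show ?thesis unfolding tick_def by simp
qed

text \<open>
In the applications, \<open>x\<close> is \<open>a + b\<close>, in which all budgets are expressed, and \<open>y\<close> is the binary logarithm of \<open>p\<close>.
\<close>

lemma decides_within_of_runs:
  assumes "runs M K c (\<lambda>s'. s' 0 \<noteq> 0 \<longleftrightarrow> Q) (init xs)" "K * tick M \<le> C * x ^ k" "real x \<le> y"
  shows "decides_within c xs Q (real C * y ^ k)"
proof -
  obtain t s where ts: "exec c (init xs) t s" "t \<le> K * tick M" "s 0 \<noteq> 0 \<longleftrightarrow> Q"
    using assms(1) unfolding runs_def by blast
  have "real t \<le> real (C * x ^ k)" using ts(2) assms(2) by linarith
  also have "\<dots> = real C * real x ^ k" by simp
  also have "\<dots> \<le> real C * y ^ k" using assms(3) by (intro mult_left_mono power_mono) auto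
  finally show ?thesis unfolding decides_within_def using ts by blast
qed

lemma exponent_sum_le_log: "real (a + b) \<le> log 2 (real (p_of a b))"
proof (rule le_log2_of_power)
  show "2 ^ (a + b) \<le> p_of a b" using power2_le_Suc_m_of[of a b] m_of_less_p_of[of a b] by linarith
qed

text \<open>
The two largest quantities that occur: the square of the bisection bounds in the divisor test, of
order \<open>p ^ 4\<close>, and the search bound. The constant 1000 is generous; \<open>8 * x \<le> 2 ^ (3 + x)\<close> with \<open>x \<ge> 2\<close>
accounts for the search bound.
\<close>

lemma memory_bounds:
  assumes "a \<ge> 1" "b \<ge> 1"
  shows "16 * p_of a b ^ 4 \<le> 2 ^ (1000 * (a + b))" "(8 * (a + b)) ^ 264 \<le> 2 ^ (1000 * (a + b))"
proof -
  define x where "x = a + b"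
  have x: "x \<ge> 2" using assms unfolding x_def by simp
  have "p_of a b ^ 4 \<le> (2 ^ (4 * x)) ^ 4"
    using p_of_less_power2[OF assms(1), of b] unfolding x_def by (intro power_mono) auto
  then have "16 * p_of a b ^ 4 \<le> 2 ^ 4 * (2 ^ (4 * x)) ^ 4" by (intro mult_mono) simp_all
  also have "\<dots> = 2 ^ 4 * 2 ^ (4 * x * 4)" by (simp only: power_mult)
  also have "\<dots> = (2::nat) ^ (4 + 4 * x * 4)" by (rule power_add[symmetric])
  also have "\<dots> \<le> 2 ^ (1000 * x)" using x by (intro power_increasing) auto
  finally show "16 * p_of a b ^ 4 \<le> 2 ^ (1000 * (a + b))" unfolding x_def .
  have "8 * x \<le> 2 ^ 3 * 2 ^ x" using less_exp[of x] by simp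
  also have "\<dots> = (2::nat) ^ (3 + x)" by (rule power_add[symmetric])
  finally have "(8 * x) ^ 264 \<le> (2 ^ (3 + x)) ^ 264" by (intro power_mono) auto
  also have "\<dots> = 2 ^ ((3 + x) * 264)" by (rule power_mult[symmetric])
  also have "\<dots> \<le> 2 ^ (1000 * x)" using x by (intro power_increasing) auto
  finally show "(8 * (a + b)) ^ 264 \<le> 2 ^ (1000 * (a + b))" unfolding x_def .
qed

lemma prime_decidable_poly:
  "\<exists>(c :: com) (C :: real) (k :: nat). \<forall>a b :: nat. a \<ge> 1 \<longrightarrow> b \<ge> 1 \<longrightarrow>
     decides_within c [a, b] (prime (p_of a b)) (C * log 2 (real (p_of a b)) ^ k)"
proof -
  have "poly_bounded (\<lambda>x. (3 * x + 2 * (((24 + 18 * (4 * x)) * (8 * x) ^ 264 + 7) * (4 * x + 1))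
      + 8 * (4 * x) + 29) * (1 + 1000 * (2 + 1000 * x)\<^sup>2))"
    by (intro poly_bounded_intros)
  then obtain C k where Ck: "\<And>x :: nat. x \<ge> 1 \<Longrightarrow>
      (3 * x + 2 * (((24 + 18 * (4 * x)) * (8 * x) ^ 264 + 7) * (4 * x + 1))
      + 8 * (4 * x) + 29) * (1 + 1000 * (2 + 1000 * x)\<^sup>2) \<le> C * x ^ k"
    unfolding poly_bounded_def by blast
  have "decides_within decide_prime [a, b] (prime (p_of a b)) (real C * log 2 (real (p_of a b)) ^ k)"
    if ab: "a \<ge> 1" "b \<ge> 1" for a b
  proof (rule decides_within_of_runs[OF _ _ exponent_sum_le_log])
    show "runs (2 ^ (1000 * (a + b)))
        (3 * (a + b) + 2 * (((24 + 18 * (4 * (a + b))) * (8 * (a + b)) ^ 264 + 7) * (4 * (a + b) + 1))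
          + 8 * (4 * (a + b)) + 29)
        decide_prime (\<lambda>s'. s' 0 \<noteq> 0 \<longleftrightarrow> prime (p_of a b)) (init [a, b])"
      by (rule runs_decide_prime[OF _ _ ab refl p_of_less_power2[OF ab(1)]
            memory_bounds[OF ab] refl refl]) (simp_all add: init_def)
  next
    show "(3 * (a + b) + 2 * (((24 + 18 * (4 * (a + b))) * (8 * (a + b)) ^ 264 + 7) * (4 * (a + b) + 1))
          + 8 * (4 * (a + b)) + 29) * tick (2 ^ (1000 * (a + b))) \<le> C * (a + b) ^ k"
      unfolding tick_power2 by (rule Ck) (use ab in linarith)
  qed
  then show ?thesis by blast
qed

lemma witness_check_poly:
  "\<exists>(c :: com) (C :: real) (k :: nat). \<forall>a b w2 w3 :: nat. a \<ge> 1 \<longrightarrow> b \<ge> 1 \<longrightarrow>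
     w2 < p_of a b \<longrightarrow> w3 < p_of a b \<longrightarrow>
     decides_within c [a, b, w2, w3]
       (witness (p_of a b) 2 (int w2) \<and> witness (p_of a b) 3 (int w3))
       (C * log 2 (real (p_of a b)) ^ k)"
proof -
  have "poly_bounded (\<lambda>x. (3 * x + 36 * (4 * x) + 54) * (1 + 1000 * (2 + 1000 * x)\<^sup>2))"
    by (intro poly_bounded_intros)
  then obtain C k where Ck: "\<And>x :: nat. x \<ge> 1 \<Longrightarrow>
      (3 * x + 36 * (4 * x) + 54) * (1 + 1000 * (2 + 1000 * x)\<^sup>2) \<le> C * x ^ k"
    unfolding poly_bounded_def by blast
  have "decides_within check_witnesses [a, b, w2, w3]
      (witness (p_of a b) 2 (int w2) \<and> witness (p_of a b) 3 (int w3))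
      (real C * log 2 (real (p_of a b)) ^ k)"
    if ab: "a \<ge> 1" "b \<ge> 1" and w: "w2 < p_of a b" "w3 < p_of a b" for a b w2 w3
  proof (rule decides_within_of_runs[OF _ _ exponent_sum_le_log])
    let ?p = "p_of a b"
    have "1 * 1 \<le> ?p * ?p" using p_of_ge[OF ab] by (intro mult_mono) auto
    then have "?p * ?p * 1 \<le> ?p * ?p * (?p * ?p)" by (intro mult_left_mono) auto
    then have "3 * (?p * ?p) \<le> 16 * ?p ^ 4" unfolding power4_eq_xxxx mult.assoc by linarith
    then have "3 * ?p * ?p \<le> 2 ^ (1000 * (a + b))"
      using memory_bounds(1)[OF ab] unfolding mult.assoc by linarith
    then show "runs (2 ^ (1000 * (a + b))) (3 * (a + b) + 36 * (4 * (a + b)) + 54) check_witnesses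
        (\<lambda>s'. s' 0 \<noteq> 0 \<longleftrightarrow> witness ?p 2 (int w2) \<and> witness ?p 3 (int w3)) (init [a, b, w2, w3])"
      using p_of_less_power2[OF ab(1), of b] ab w
      by (intro runs_check_witnesses) (simp_all add: init_def)
  next
    show "(3 * (a + b) + 36 * (4 * (a + b)) + 54) * tick (2 ^ (1000 * (a + b))) \<le> C * (a + b) ^ k"
      unfolding tick_power2 by (rule Ck) (use ab in linarith)
  qed
  then show ?thesis by blast
qed

theorem theorem3p7:
  shows
    "(\<forall>a b :: nat. a \<ge> 1 \<longrightarrow> b \<ge> 1 \<longrightarrow>
        (prime (p_of a b) \<longleftrightarrow>
          (\<exists>w2 w3 :: int. witness (p_of a b) 2 w2 \<and> witness (p_of a b) 3 w3)))
   \<and> (\<exists>(c :: com) (C :: real) (k :: nat). \<forall>a b :: nat. a \<ge> 1 \<longrightarrow> b \<ge> 1 \<longrightarrow>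
        decides_within c [a, b] (prime (p_of a b)) (C * log 2 (real (p_of a b)) ^ k))
   \<and> (\<exists>(c :: com) (C :: real) (k :: nat). \<forall>a b w2 w3 :: nat. a \<ge> 1 \<longrightarrow> b \<ge> 1 \<longrightarrow>
        w2 < p_of a b \<longrightarrow> w3 < p_of a b \<longrightarrow>
        decides_within c [a, b, w2, w3]
          (witness (p_of a b) 2 (int w2) \<and> witness (p_of a b) 3 (int w3))
          (C * log 2 (real (p_of a b)) ^ k))"
  using prime_iff_witnesses prime_decidable_poly witness_check_poly by (intro conjI) blast+

end
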